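(* Consider the SVRG method (defined in the context) with noisy data $y^\delta$, $\|y^\delta-y\|\le\delta$, where the step sizes $\gamma_0>0$ and $\gamma_1>0$ satisfy $$1-\gamma_1 L>0\quad\text{and}\quad 2\gamma_0-\gamma_0^2\|A\|^2-\frac{2m\gamma_1^2L}{N}>0 .$$ Let $x^\dagger$ denote the unique $x_0$-minimal norm solution of $Ax=y$. If the (deterministic) integers $n_\delta$ are chosen such that $n_\delta\to\infty$ and $\delta^2n_\delta\to0$ as $\delta\to0$, then $$\mathbb{E}\left[\|x_{n_\delta}^\delta-x^\dagger\|^2\right]\to0\quad\text{as }\delta\to0 .$$
   Context: Setting. $X$ and $Y_1,\dots,Y_N$ are Hilbert spaces, $A_i:X\to Y_i$ are bounded linear operators, $Y=Y_1\times\cdots\times Y_N$ with the natural product inner product, and $Ax=(A_1x,\dots,A_Nx)$, so $A^*z=\sum_{i=1}^N A_i^*z_i$. $L:=\max\{\|A_i\|^2: i=1,\dots,N\}$. The exact data $y=(y_1,\dots,y_N)$ lies in $\mathrm{Ran}(A)$. Given $x_0\in X$, $x^\dagger$ is the unique $x_0$-minimal norm solution, i.e. the solution of $Ax=y$ minimizing $\|x-x_0\|$. For each $\delta>0$, noisy data $y^\delta\in Y$ satisfy $\|y^\delta-y\|\le\delta$. SVRG method. Given an integer $m\ge1$, $x_0\in X$ and step sizes $\gamma_0,\gamma_1$ (all independent of $\delta$), let $i_{n,k}$ ($n\ge0$, $0\le k\le m-1$) be independent random indices uniformly distributed on $\{1,\dots,N\}$. Set $x_0^\delta=x_0$, and for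 $n=0,1,\dots$: $g_n^\delta=A^*(Ax_n^\delta-y^\delta)$; $x_{n,0}^\delta=x_n^\delta-\gamma_0g_n^\delta$; for $k=0,\dots,m-1$, $$x_{n,k+1}^\delta=x_{n,k}^\delta-\gamma_1\left(A_{i_{n,k}}^*A_{i_{n,k}}(x_{n,k}^\delta-x_n^\delta)+\tfrac1N g_n^\delta\right);$$ and $x_{n+1}^\delta=x_{n,m}^\delta$. $\mathbb{E}$ is the expectation with respect to the random indices. *)

theory Defs
  imports "HOL-Probability.Probability"
begin

text \<open>
  The component operators are indexed by a finite type, so that the number of components
  is \<open>N = CARD('n)\<close>, and the product space carries the inner product of \<open>'b ^ 'n\<close>,
  i.e. the sum of the componentwise inner products. The Hilbert spaces \<open>Y i\<close>, which
  may differ from each other, are represented by closed subspaces of a common Hilbert space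
  \<open>'b\<close>; this is no restriction, because \<open>'b\<close> can be taken to be the direct sum of the
  given spaces. For an operator with range in \<open>Y i\<close>, the adjoint taken with
  respect to \<open>'b\<close> agrees on \<open>Y i\<close> with the adjoint taken with respect to \<open>Y i\<close>.
\<close>

definition stack :: "('n::finite \<Rightarrow> 'a \<Rightarrow> 'b) \<Rightarrow> 'a \<Rightarrow> 'b ^ 'n" where
  "stack A x = (\<chi> i. A i x)"

definition max_sq_norm :: "('n::finite \<Rightarrow> 'a::real_normed_vector \<Rightarrow> 'b::real_normed_vector) \<Rightarrow> real" where
  "max_sq_norm A = Max (range (\<lambda>i. (onorm (A i))\<^sup>2))"

definition min_norm_solution :: "('a::real_normed_vector \<Rightarrow> 'c) \<Rightarrow> 'c \<Rightarrow> 'a \<Rightarrow> 'a" where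
  "min_norm_solution T y x0 = (THE x. is_arg_min (\<lambda>z. norm (z - x0)) (\<lambda>z. T z = y) x)"

definition full_gradient ::
    "('n::finite \<Rightarrow> 'a::real_inner \<Rightarrow> 'b::real_inner) \<Rightarrow> 'b ^ 'n \<Rightarrow> 'a \<Rightarrow> 'a" where
  "full_gradient A y x = adjoint (stack A) (stack A x - y)"

text \<open>
  In \<open>svrg_inner\<close>, the argument \<open>x\<close> is the anchor point of the current epoch and
  \<open>j k\<close> is the index used in its \<open>k\<close>-th inner step; in \<open>svrg\<close>, \<open>i n k\<close> is the
  index used in the \<open>k\<close>-th inner step of epoch \<open>n\<close>.
\<close>

primrec svrg_inner ::
    "('n::finite \<Rightarrow> 'a::real_inner \<Rightarrow> 'b::real_inner) \<Rightarrow> 'b ^ 'n \<Rightarrow> real \<Rightarrow> real \<Rightarrow> 'a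
      \<Rightarrow> (nat \<Rightarrow> 'n) \<Rightarrow> nat \<Rightarrow> 'a" where
  "svrg_inner A y \<gamma>\<^sub>0 \<gamma>\<^sub>1 x j 0 = x - \<gamma>\<^sub>0 *\<^sub>R full_gradient A y x"
| "svrg_inner A y \<gamma>\<^sub>0 \<gamma>\<^sub>1 x j (Suc k) =
     svrg_inner A y \<gamma>\<^sub>0 \<gamma>\<^sub>1 x j k
       - \<gamma>\<^sub>1 *\<^sub>R (adjoint (A (j k)) (A (j k) (svrg_inner A y \<gamma>\<^sub>0 \<gamma>\<^sub>1 x j k - x))
                + (1 / real CARD('n)) *\<^sub>R full_gradient A y x)"

primrec svrg ::
    "('n::finite \<Rightarrow> 'a::real_inner \<Rightarrow> 'b::real_inner) \<Rightarrow> 'b ^ 'n \<Rightarrow> real \<Rightarrow> real \<Rightarrow> nat \<Rightarrow> 'a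
      \<Rightarrow> (nat \<Rightarrow> nat \<Rightarrow> 'n) \<Rightarrow> nat \<Rightarrow> 'a" where
  "svrg A y \<gamma>\<^sub>0 \<gamma>\<^sub>1 m x0 i 0 = x0"
| "svrg A y \<gamma>\<^sub>0 \<gamma>\<^sub>1 m x0 i (Suc n) =
     svrg_inner A y \<gamma>\<^sub>0 \<gamma>\<^sub>1 (svrg A y \<gamma>\<^sub>0 \<gamma>\<^sub>1 m x0 i n) (i n) m"

end

theory Submission imports Defs begin

text \<open>
  The iteration is affine in the starting point and the data. So, for \<open>w = y\<delta> - y\<close> and any \<open>v\<close>,
  the error splits into the noise-free iteration started at \<open>A\<^sup>* v\<close> and the
  iteration with data \<open>w\<close> started at \<open>x\<^sub>0 - x\<^sup>\<dagger> - A\<^sup>* v\<close>. An energy estimate bounds the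
  mean square of the latter by \<open>\<parallel>x\<^sub>0 - x\<^sup>\<dagger> - A\<^sup>* v\<parallel>\<^sup>2 + C n \<delta>\<^sup>2\<close>, whose first term can be made
  small because \<open>x\<^sub>0 - x\<^sup>\<dagger>\<close> is orthogonal to the kernel of \<open>A\<close> and hence lies in the closure of
  the range of \<open>A\<^sup>*\<close>. For the former, the same estimate shows that the mean square residuals are
  summable over all inner and outer steps. The noise-free iterates are \<open>A\<^sup>* v\<^sub>n\<close> for an iteration
  \<open>v\<^sub>n\<close> in the data space whose mean square grows by at most a multiple of these residuals and
  hence stays bounded; since \<open>\<parallel>A\<^sup>* v\<^sub>n\<parallel>\<^sup>2\<close> is the inner product of \<open>v\<^sub>n\<close> with the residual
  \<open>A A\<^sup>* v\<^sub>n\<close>, which tends to zero in mean square, the iterates tend to zero.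
\<close>

subsection \<open>Hilbert spaces\<close>

text \<open>First-order optimality in scalar form: t^2 c - 2 t b is minimal at t = 0, so its slope
  there vanishes. It turns minimality along a line into orthogonality.\<close>

lemma eq_0_if_linear_le_quadratic:
  fixes b c :: real
  assumes "\<And>t. 2 * t * b \<le> t\<^sup>2 * c"
  shows "b = 0"
proof -
  have c: "c \<ge> 0"
    using assms[of 1] assms[of "-1"] by simp
  \<comment> \<open>The natural choice b / c fails for c = 0; with \<open>c + 1\<close> no case
    split arises and the hypothesis becomes t^2 (c + 2) \<le> 0.\<close>
  define t where "t = b / (c + 1)"
  have b: "b = t * (c + 1)"
    using c by (simp add: t_def)
  have "t\<^sup>2 * (c + 2) \<le> 0"
    using assms[of t] by (simp add: b algebra_simps power2_eq_square)
  then have "t = 0"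
    using c by (simp add: mult_le_0_iff)
  then show ?thesis by (simp add: b)
qed

section \<open>Nearest points and orthogonality\<close>

lemma parallelogram:
  fixes a b :: "'a::real_inner"
  shows "(norm (a + b))\<^sup>2 + (norm (a - b))\<^sup>2 = 2 * (norm a)\<^sup>2 + 2 * (norm b)\<^sup>2"
  by (simp add: power2_norm_eq_inner inner_add inner_diff inner_commute)

text \<open>A minimizing sequence is Cauchy by the parallelogram law, because midpoints stay in the
  convex set; completeness and closedness then give the minimizer.\<close>

lemma nearest_point_exists:
  fixes S :: "'a::{real_inner,complete_space} set"
  assumes "closed S" "convex S" "S \<noteq> {}"
  obtains p where "p \<in> S" "\<And>z. z \<in> S \<Longrightarrow> norm (p - x) \<le> norm (z - x)"
proof -
  define D where "D = Inf ((\<lambda>z. (norm (z - x))\<^sup>2) ` S)"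
  have bdd: "bdd_below ((\<lambda>z. (norm (z - x))\<^sup>2) ` S)"
    by (rule bdd_belowI[of _ 0]) auto
  have D: "D \<le> (norm (z - x))\<^sup>2" if "z \<in> S" for z
    unfolding D_def using that bdd by (auto intro: cInf_lower)
  have "\<exists>z\<in>S. (norm (z - x))\<^sup>2 < D + inverse (real (Suc n))" for n
    using cInf_lessD[of "(\<lambda>z. (norm (z - x))\<^sup>2) ` S" "D + inverse (real (Suc n))"] assms(3)
    by (auto simp: D_def)
  then obtain s where s: "\<And>n. s n \<in> S" "\<And>n. (norm (s n - x))\<^sup>2 < D + inverse (real (Suc n))"
    by metis
  \<comment> \<open>The midpoint of \<open>s i\<close> and \<open>s j\<close> is in
    \<open>S\<close>, so the sum of \<open>s i - x\<close> and \<open>s j - x\<close> has squared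
    norm at least \<open>4 * D\<close>. In the parallelogram law this cancels all but the excess of
    the two terms over \<open>D\<close>.\<close>
  have close: "(norm (s i - s j))\<^sup>2 \<le> 2 * inverse (real (Suc i)) + 2 * inverse (real (Suc j))" for i j
  proof -
    have "(1/2) *\<^sub>R s i + (1/2) *\<^sub>R s j \<in> S"
      using assms(2) s(1) by (intro convexD) auto
    from D[OF this] have "4 * D \<le> (norm (2 *\<^sub>R ((1/2) *\<^sub>R s i + (1/2) *\<^sub>R s j - x)))\<^sup>2"
      by (simp add: power_mult_distrib)
    also have "2 *\<^sub>R ((1/2) *\<^sub>R s i + (1/2) *\<^sub>R s j - x) = (s i - x) + (s j - x)"
      by (simp add: algebra_simps scaleR_2)
    finally have "4 * D \<le> (norm ((s i - x) + (s j - x)))\<^sup>2" .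
    moreover have "s i - s j = (s i - x) - (s j - x)" by simp
    ultimately show ?thesis
      using parallelogram[of "s i - x" "s j - x"] s(2)[of i] s(2)[of j] by simp
  qed
  have "Cauchy s"
  proof (rule metric_CauchyI)
    fix e :: real assume e: "e > 0"
    obtain N where N: "inverse (real (Suc N)) < e\<^sup>2 / 4"
      using reals_Archimedean[of "e\<^sup>2 / 4"] e by auto
    have "dist (s i) (s j) < e" if "i \<ge> N" "j \<ge> N" for i j
    proof -
      have "inverse (real (Suc i)) \<le> inverse (real (Suc N))"
        "inverse (real (Suc j)) \<le> inverse (real (Suc N))"
        using that by simp_all
      then have "(norm (s i - s j))\<^sup>2 < e\<^sup>2"
        using close[of i j] N by linarith
      then show ?thesis
        using e by (simp add: dist_norm power_less_imp_less_base)
    qed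
    then show "\<exists>N. \<forall>i\<ge>N. \<forall>j\<ge>N. dist (s i) (s j) < e" by blast
  qed
  then obtain p where p: "s \<longlonglongrightarrow> p"
    using Cauchy_convergent_iff convergent_def by blast
  have "p \<in> S"
    using closed_sequentially[OF assms(1) _ p] s(1) by blast
  moreover have "norm (p - x) \<le> norm (z - x)" if "z \<in> S" for z
  proof -
    have "(\<lambda>n. (norm (s n - x))\<^sup>2) \<longlonglongrightarrow> (norm (p - x))\<^sup>2"
      by (intro tendsto_intros p)
    moreover have "(\<lambda>n. D + inverse (real (Suc n))) \<longlonglongrightarrow> D + 0"
      by (intro tendsto_intros LIMSEQ_inverse_real_of_nat)
    ultimately have "(norm (p - x))\<^sup>2 \<le> D + 0"
      by (rule LIMSEQ_le) (use s(2) less_imp_le in blast)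
    then have "(norm (p - x))\<^sup>2 \<le> (norm (z - x))\<^sup>2"
      using D[OF that] by linarith
    then show ?thesis by (rule power2_le_imp_le) simp
  qed
  ultimately show ?thesis using that by blast
qed

text \<open>Compare \<open>p\<close> with the points of the line through it in direction
  \<open>d\<close>. Requiring just this line to lie in \<open>S\<close> serves affine solution sets
  and subspaces alike.\<close>

lemma nearest_point_orthogonal:
  fixes x :: "'a::real_inner"
  assumes "\<And>z. z \<in> S \<Longrightarrow> norm (p - x) \<le> norm (z - x)" and "\<And>t. p + t *\<^sub>R d \<in> S"
  shows "inner (x - p) d = 0"
proof (rule eq_0_if_linear_le_quadratic)
  fix t :: real
  have "(norm (p - x))\<^sup>2 \<le> (norm (p + t *\<^sub>R d - x))\<^sup>2"
    using assms by (simp add: power_mono)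
  then show "2 * t * inner (x - p) d \<le> t\<^sup>2 * (norm d)\<^sup>2"
    unfolding power2_norm_eq_inner
    by (simp add: inner_add inner_diff inner_commute algebra_simps power2_eq_square)
qed

section \<open>Riesz representation and adjoints\<close>

text \<open>The point \<open>p\<close> of least norm on the hyperplane f = 1 is orthogonal to the
  kernel of \<open>f\<close>, and each \<open>z\<close> differs from \<open>f z *\<^sub>R p\<close>
  by a kernel element.\<close>

lemma riesz_representation:
  fixes f :: "'a::{real_inner,complete_space} \<Rightarrow> real"
  assumes "bounded_linear f"
  obtains u where "\<And>x. f x = inner x u"
proof (cases "\<forall>x. f x = 0")
  case True
  then show ?thesis using that[of 0] by simp
next
  case False
  interpret f: bounded_linear f by fact
  from False obtain x where x: "f x \<noteq> 0" by blast
  define S where "S = {x. f x = 1}"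
  have "closed S"
    unfolding S_def by (intro closed_Collect_eq continuous_intros f.continuous_on)
  moreover have "convex S"
    by (auto simp: S_def convex_def f.add f.scaleR)
  moreover have "S \<noteq> {}"
    using x by (auto simp: S_def f.scaleR intro!: exI[of _ "(1 / f x) *\<^sub>R x"])
  ultimately obtain p where p: "p \<in> S" "\<And>z. z \<in> S \<Longrightarrow> norm (p - 0) \<le> norm (z - 0)"
    using nearest_point_exists[of S 0] by blast
  have fp: "f p = 1" using p(1) by (simp add: S_def)
  then have p0: "inner p p \<noteq> 0" by (auto simp: f.zero)
  have "f z = inner z ((1 / inner p p) *\<^sub>R p)" for z
  proof -
    have "inner (0 - p) (z - f z *\<^sub>R p) = 0"
      by (rule nearest_point_orthogonal[of S]) (use p(2) in \<open>auto simp: S_def f.add f.scaleR f.diff fp\<close>)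
    then show ?thesis
      using p0 by (simp add: inner_diff inner_commute field_simps)
  qed
  then show ?thesis using that by blast
qed

text \<open>\<open>adjoint\<close> is defined by choice, so some map with the adjoint property must
  be exhibited first; Riesz representation of each functional
  \<open>\<lambda>x. inner (T x) z\<close> supplies it.\<close>

lemma inner_adjoint:
  fixes T :: "'a::{real_inner,complete_space} \<Rightarrow> 'b::real_inner"
  assumes "bounded_linear T"
  shows "inner (T x) z = inner x (adjoint T z)"
proof -
  have "\<exists>u. \<forall>x. inner (T x) z = inner x u" for z
    using riesz_representation[of "\<lambda>x. inner (T x) z"]
      bounded_linear_compose[OF bounded_linear_inner_left assms] by metis
  then have "\<exists>g. \<forall>x z. inner (T x) z = inner x (g z)"
    by metis
  then have "\<forall>x z. inner (T x) z = inner x (adjoint T z)"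
    unfolding adjoint_def by (rule someI_ex)
  then show ?thesis by blast
qed

lemma norm_adjoint_le:
  fixes T :: "'a::{real_inner,complete_space} \<Rightarrow> 'b::real_inner"
  assumes "bounded_linear T"
  shows "norm (adjoint T z) \<le> onorm T * norm z"
proof -
  have "(norm (adjoint T z))\<^sup>2 = inner (T (adjoint T z)) z"
    by (simp add: power2_norm_eq_inner inner_adjoint[OF assms])
  also have "\<dots> \<le> norm (T (adjoint T z)) * norm z"
    by (rule norm_cauchy_schwarz)
  also have "\<dots> \<le> (onorm T * norm (adjoint T z)) * norm z"
    by (intro mult_right_mono onorm[OF assms]) simp
  finally have "norm (adjoint T z) * norm (adjoint T z) \<le> norm (adjoint T z) * (onorm T * norm z)"
    by (simp add: power2_eq_square mult_ac)
  then show ?thesis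
    using onorm_pos_le[OF assms] by (cases "norm (adjoint T z) = 0") (auto simp: mult_le_cancel_left)
qed

lemma bounded_linear_adjoint:
  fixes T :: "'a::{real_inner,complete_space} \<Rightarrow> 'b::real_inner"
  assumes "bounded_linear T"
  shows "bounded_linear (adjoint T)"
proof (rule bounded_linear_intro[where K = "onorm T"])
  fix z w and t :: real
  have "inner x (adjoint T (z + w)) = inner x (adjoint T z + adjoint T w)" for x
    by (simp add: inner_adjoint[OF assms, symmetric] inner_add_right)
  then show "adjoint T (z + w) = adjoint T z + adjoint T w"
    by (metis vector_eq_rdot inner_commute)
  have "inner x (adjoint T (t *\<^sub>R z)) = inner x (t *\<^sub>R adjoint T z)" for x
    by (simp add: inner_adjoint[OF assms, symmetric])
  then show "adjoint T (t *\<^sub>R z) = t *\<^sub>R adjoint T z"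
    by (metis vector_eq_rdot inner_commute)
qed (simp add: norm_adjoint_le[OF assms] mult.commute)

section \<open>Minimal-norm solutions and the range of the adjoint\<close>

text \<open>The solution set is closed and convex, so a nearest point \<open>p\<close> to
  \<open>x0\<close> exists, and moving it along the kernel shows orthogonality. By Pythagoras any
  other minimizer equals \<open>p\<close>, so the description in \<open>min_norm_solution\<close>
  denotes \<open>p\<close>.\<close>

lemma min_norm_solution_properties:
  fixes T :: "'a::{real_inner,complete_space} \<Rightarrow> 'b::real_inner"
  assumes T: "bounded_linear T" and y: "y \<in> range T"
  shows "T (min_norm_solution T y x0) = y"
    and "T d = 0 \<Longrightarrow> inner (x0 - min_norm_solution T y x0) d = 0"
proof -
  interpret T: bounded_linear T by fact
  define S where "S = {x. T x = y}"
  have cl: "closed S"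
    unfolding S_def by (intro closed_Collect_eq continuous_intros T.continuous_on)
  have cv: "convex S"
  proof -
    have "u *\<^sub>R y + v *\<^sub>R y = y" if "u + v = 1" for u v :: real
      using that by (metis scaleR_add_left scaleR_one)
    then show ?thesis by (auto simp: S_def convex_def T.add T.scaleR)
  qed
  have ne: "S \<noteq> {}" using y by (auto simp: S_def)
  obtain p where p: "p \<in> S" "\<And>z. z \<in> S \<Longrightarrow> norm (p - x0) \<le> norm (z - x0)"
    using nearest_point_exists[OF cl cv ne] by metis
  have orth: "inner (x0 - p) d = 0" if "T d = 0" for d
    by (rule nearest_point_orthogonal[of S]) (use p that in \<open>auto simp: S_def T.add T.scaleR\<close>)
  have "min_norm_solution T y x0 = p"
    unfolding min_norm_solution_def
  proof (rule the_equality)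
    show "is_arg_min (\<lambda>z. norm (z - x0)) (\<lambda>z. T z = y) p"
      using p by (auto simp: is_arg_min_def S_def not_less)
  next
    fix q assume "is_arg_min (\<lambda>z. norm (z - x0)) (\<lambda>z. T z = y) q"
    then have q: "T q = y" and "norm (q - x0) \<le> norm (p - x0)"
      using p(1) by (auto simp: is_arg_min_def S_def not_less)
    then have le: "(norm (q - x0))\<^sup>2 \<le> (norm (p - x0))\<^sup>2"
      by (simp add: power_mono)
    have "inner (x0 - p) (q - p) = 0"
      by (rule orth) (use p(1) q in \<open>simp add: T.diff S_def\<close>)
    moreover have "(norm (q - x0))\<^sup>2 = (norm (p - x0))\<^sup>2 + (norm (q - p))\<^sup>2 - 2 * inner (x0 - p) (q - p)"
      by (simp add: power2_norm_eq_inner inner_diff inner_commute)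
    ultimately have "(norm (q - p))\<^sup>2 \<le> 0" using le by linarith
    then show "q = p" by simp
  qed
  then show "T (min_norm_solution T y x0) = y"
    "T d = 0 \<Longrightarrow> inner (x0 - min_norm_solution T y x0) d = 0"
    using p(1) orth by (auto simp: S_def)
qed

lemma subspace_closure:
  fixes S :: "'a::real_normed_vector set"
  assumes S: "subspace S"
  shows "subspace (closure S)"
proof (rule subspaceI)
  show "0 \<in> closure S"
    using subspace_0[OF S] closure_subset by blast
next
  fix x y assume "x \<in> closure S" "y \<in> closure S"
  then obtain a b where "\<And>n. a n \<in> S" "a \<longlonglongrightarrow> x" "\<And>n. b n \<in> S" "b \<longlonglongrightarrow> y"
    by (auto simp: closure_sequential)
  then have "\<And>n. a n + b n \<in> S" "(\<lambda>n. a n + b n) \<longlonglongrightarrow> x + y"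
    using subspace_add[OF S] by (auto intro: tendsto_add)
  then show "x + y \<in> closure S"
    unfolding closure_sequential by (intro exI[of _ "\<lambda>n. a n + b n"]) blast
next
  fix x and c :: real assume "x \<in> closure S"
  then obtain a where "\<And>n. a n \<in> S" "a \<longlonglongrightarrow> x"
    by (auto simp: closure_sequential)
  then have "\<And>n. c *\<^sub>R a n \<in> S" "(\<lambda>n. c *\<^sub>R a n) \<longlonglongrightarrow> c *\<^sub>R x"
    using subspace_scale[OF S] by (auto intro: tendsto_intros)
  then show "c *\<^sub>R x \<in> closure S"
    unfolding closure_sequential by (intro exI[of _ "\<lambda>n. c *\<^sub>R a n"]) blast
qed

text \<open>Project \<open>u\<close> onto the closed range. Testing the remainder
  \<open>u - p\<close> against \<open>adjoint T (T (u - p))\<close> puts it in the kernel of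
  \<open>T\<close>; it is then orthogonal both to \<open>u\<close> and to \<open>p\<close>, hence
  zero.\<close>

lemma orthogonal_kernel_in_closure_range_adjoint:
  fixes T :: "'a::{real_inner,complete_space} \<Rightarrow> 'b::real_inner"
  assumes T: "bounded_linear T" and u: "\<And>d. T d = 0 \<Longrightarrow> inner u d = 0"
  shows "u \<in> closure (range (adjoint T))"
proof -
  interpret T': bounded_linear "adjoint T" by (rule bounded_linear_adjoint[OF T])
  define S where "S = closure (range (adjoint T))"
  have sub: "subspace S"
    unfolding S_def by (intro subspace_closure) (simp add: linear_subspace_image T'.linear_axioms)
  have "S \<noteq> {}" using sub subspace_0 by blast
  then obtain p where p: "p \<in> S" "\<And>z. z \<in> S \<Longrightarrow> norm (p - u) \<le> norm (z - u)"
    using nearest_point_exists[of S] sub subspace_imp_convex[OF sub] by (metis S_def closed_closure)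
  have orth: "inner (u - p) d = 0" if "d \<in> S" for d
    by (rule nearest_point_orthogonal[of S]) (use p that sub in \<open>auto intro: subspace_add subspace_scale\<close>)
  have "inner (T (u - p)) (T (u - p)) = 0"
    unfolding inner_adjoint[OF T] by (rule orth) (auto simp: S_def closure_def)
  then have "inner u (u - p) = 0" by (intro u) simp
  then have "inner (u - p) (u - p) = 0"
    using orth[OF p(1)] by (simp add: inner_diff inner_commute)
  then have "u = p" by simp
  with p(1) show ?thesis by (simp add: S_def)
qed

subsection \<open>Independent uniform indices\<close>

text \<open>The draws made before inner step \<open>k\<close> of epoch \<open>n\<close>, a
  combinatorial stand-in for the filtration. The bound by \<open>m\<close> keeps to pairs covered by
  the independence assumption.\<close>

definition history :: "nat \<Rightarrow> nat \<Rightarrow> nat \<Rightarrow> (nat \<times> nat) set" where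
  "history m n k = {(n', k'). k' < m \<and> (n' < n \<or> n' = n \<and> k' < k)}"

text \<open>Replaces measurability with respect to the draws in \<open>J\<close>: the indices are
  discrete, so for finite \<open>J\<close> dependence on these draws alone is enough.\<close>

definition determined_on :: "(nat \<times> nat) set \<Rightarrow> ((nat \<Rightarrow> nat \<Rightarrow> 'n) \<Rightarrow> 'c) \<Rightarrow> bool" where
  "determined_on J F \<longleftrightarrow> (\<forall>i j. (\<forall>(n, k)\<in>J. i n k = j n k) \<longrightarrow> F i = F j)"

lemma finite_history: "finite (history m n k)"
  by (rule finite_subset[of _ "{..n} \<times> {..<m}"]) (auto simp: history_def)

lemma history_subset: "history m n k \<subseteq> UNIV \<times> {..<m}"
  by (auto simp: history_def)

lemma current_notin_history: "(n, k) \<notin> history m n k"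
  by (auto simp: history_def)

lemma determined_on_comp: "determined_on J F \<Longrightarrow> determined_on J (\<lambda>i. f (F i))"
  unfolding determined_on_def by metis

lemma determined_on_comp2:
  "determined_on J F \<Longrightarrow> determined_on J G \<Longrightarrow> determined_on J (\<lambda>i. f (F i) (G i))"
  unfolding determined_on_def by metis

locale uniform_indices = prob_space M for M :: "'w measure" +
  fixes idx :: "nat \<Rightarrow> nat \<Rightarrow> 'w \<Rightarrow> 'n::finite" and m :: nat
  assumes indep_idx: "indep_vars (\<lambda>_. count_space UNIV) (\<lambda>(n, k). idx n k) (UNIV \<times> {..<m})"
    and uniform_idx: "k < m \<Longrightarrow>
      distr M (count_space UNIV) (idx n k) = uniform_count_measure UNIV"
begin

abbreviation E :: "((nat \<Rightarrow> nat \<Rightarrow> 'n) \<Rightarrow> real) \<Rightarrow> real" where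
  "E F \<equiv> expectation (\<lambda>\<omega>. F (\<lambda>n k. idx n k \<omega>))"

lemma measurable_idx: "k < m \<Longrightarrow> idx n k \<in> measurable M (count_space UNIV)"
  using indep_idx by (auto simp: indep_vars_def2)

lemma PiM_indices:
  "finite J \<Longrightarrow> PiM J (\<lambda>_. count_space (UNIV :: 'n set)) = count_space (PiE J (\<lambda>_. UNIV))"
  by (rule count_space_PiM_finite) auto

lemma determined_on_restrict:
  assumes "determined_on J F"
  shows "F (\<lambda>n k. idx n k \<omega>) = F (\<lambda>n k. restrict (\<lambda>p. (\<lambda>(n, k). idx n k) p \<omega>) J (n, k))"
proof -
  define i j where "i = (\<lambda>n k. idx n k \<omega>)"
    and "j = (\<lambda>n k. restrict (\<lambda>p. (\<lambda>(n, k). idx n k) p \<omega>) J (n, k))"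
  have "\<forall>(n, k)\<in>J. i n k = j n k"
    by (auto simp: i_def j_def)
  then have "F i = F j"
    using assms unfolding determined_on_def by blast
  then show ?thesis by (simp only: i_def j_def)
qed

text \<open>\<open>F\<close> factors through the restriction of the index array to \<open>J\<close>,
  which takes finitely many values in a discrete space; so it is measurable and bounded.\<close>

lemma integrable_determined:
  fixes F :: "(nat \<Rightarrow> nat \<Rightarrow> 'n) \<Rightarrow> real"
  assumes J: "finite J" "J \<subseteq> UNIV \<times> {..<m}" and F: "determined_on J F"
  shows "integrable M (\<lambda>\<omega>. F (\<lambda>n k. idx n k \<omega>))"
proof -
  let ?X = "\<lambda>\<omega>. restrict (\<lambda>p. (\<lambda>(n, k). idx n k) p \<omega>) J"
  let ?G = "\<lambda>f :: nat \<times> nat \<Rightarrow> 'n. F (\<lambda>n k. f (n, k))"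
  have eq: "F (\<lambda>n k. idx n k \<omega>) = ?G (?X \<omega>)" for \<omega>
    by (rule determined_on_restrict[OF F])
  have "?X \<in> measurable M (PiM J (\<lambda>_. count_space UNIV))"
    by (rule measurable_restrict) (use J(2) measurable_idx in auto)
  then have "?X \<in> measurable M (count_space (PiE J (\<lambda>_. UNIV)))"
    by (simp only: PiM_indices[OF J(1)])
  then have meas: "(\<lambda>\<omega>. ?G (?X \<omega>)) \<in> borel_measurable M"
    by (rule measurable_compose) simp
  have "finite (PiE J (\<lambda>_. UNIV :: 'n set))"
    using J(1) by (intro finite_PiE) auto
  then have "bounded (?G ` PiE J (\<lambda>_. UNIV :: 'n set))"
    by (intro finite_imp_bounded finite_imageI)
  then obtain B where B: "\<And>f. f \<in> PiE J (\<lambda>_. UNIV) \<Longrightarrow> norm (?G f) \<le> B"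
    by (auto simp: bounded_iff)
  have "integrable M (\<lambda>\<omega>. ?G (?X \<omega>))"
  proof (rule integrable_const_bound[OF AE_I2 meas])
    show "norm (?G (?X \<omega>)) \<le> B" for \<omega>
      by (rule B) auto
  qed
  then show ?thesis by (simp only: eq)
qed

text \<open>Conditioning on the past by hand: split according to the value \<open>a\<close> of the
  fresh index. Each indicator has mean 1/N and is independent of \<open>F a\<close>, which sees only
  other draws.\<close>

lemma expectation_average:
  fixes F :: "'n \<Rightarrow> (nat \<Rightarrow> nat \<Rightarrow> 'n) \<Rightarrow> real"
  assumes J: "finite J" "J \<subseteq> UNIV \<times> {..<m}" "(n, k) \<notin> J" and k: "k < m"
    and F: "\<And>a. determined_on J (F a)"
  shows "E (\<lambda>i. F (i n k) i) = E (\<lambda>i. (\<Sum>a\<in>UNIV. F a i) / real CARD('n))"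
proof -
  let ?X = "\<lambda>J \<omega>. restrict (\<lambda>p. (\<lambda>(n, k). idx n k) p \<omega>) J"
  let ?P = "\<lambda>J. PiM J (\<lambda>_. count_space (UNIV :: 'n set))"
  let ?I = "\<lambda>a (i :: nat \<Rightarrow> nat \<Rightarrow> 'n). indicator {a} (i n k) :: real"
  have prob: "E (?I a) = 1 / real CARD('n)" for a
  proof -
    have "E (?I a) = integral\<^sup>L (distr M (count_space UNIV) (idx n k)) (indicator {a})"
      by (rule integral_distr[symmetric]) (use measurable_idx[OF k] in auto)
    also have "\<dots> = (\<Sum>x\<in>UNIV. indicator {a} x :: real) / real CARD('n)"
      unfolding uniform_idx[OF k] by (rule integral_uniform_count_measure) simp
    also have "(\<Sum>x\<in>UNIV. indicator {a} x :: real) = 1"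
      by (simp add: indicator_def)
    finally show ?thesis .
  qed
  have intF: "integrable M (\<lambda>\<omega>. F a (\<lambda>n k. idx n k \<omega>))" for a
    by (rule integrable_determined[OF J(1,2) F])
  have intI: "integrable M (\<lambda>\<omega>. ?I a (\<lambda>n k. idx n k \<omega>))" for a
    by (rule integrable_determined[of "{(n, k)}"]) (use k in \<open>auto simp: determined_on_def\<close>)
  have indep: "indep_var borel (\<lambda>\<omega>. ?I a (\<lambda>n k. idx n k \<omega>)) borel (\<lambda>\<omega>. F a (\<lambda>n k. idx n k \<omega>))" for a
  proof -
    have "indep_var (?P {(n, k)}) (?X {(n, k)}) (?P J) (?X J)"
      by (rule indep_var_restrict[OF indep_idx]) (use J k in auto)
    then have "indep_var borel ((\<lambda>f. indicator {a} (f (n, k)) :: real) \<circ> ?X {(n, k)})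
        borel ((\<lambda>f. F a (\<lambda>n k. f (n, k))) \<circ> ?X J)"
      by (rule indep_var_compose) (simp_all add: PiM_indices J(1))
    moreover have "(\<lambda>f. F a (\<lambda>n k. f (n, k))) \<circ> ?X J = (\<lambda>\<omega>. F a (\<lambda>n k. idx n k \<omega>))"
      unfolding comp_def determined_on_restrict[OF F] ..
    moreover have "(\<lambda>f. indicator {a} (f (n, k)) :: real) \<circ> ?X {(n, k)}
        = (\<lambda>\<omega>. ?I a (\<lambda>n k. idx n k \<omega>))"
      by (simp add: comp_def)
    ultimately show ?thesis by simp
  qed
  have "E (\<lambda>i. F (i n k) i) = E (\<lambda>i. \<Sum>a\<in>UNIV. ?I a i * F a i)"
    by (simp add: indicator_def if_distrib[of "\<lambda>x. x * _"] cong: if_cong)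
  also have "\<dots> = (\<Sum>a\<in>UNIV. E (\<lambda>i. ?I a i * F a i))"
    by (intro Bochner_Integration.integral_sum indep_var_integrable indep intF intI)
  also have "\<dots> = (\<Sum>a\<in>UNIV. E (F a) / real CARD('n))"
    by (simp add: indep_var_lebesgue_integral[OF indep intI intF] prob)
  also have "\<dots> = E (\<lambda>i. (\<Sum>a\<in>UNIV. F a i) / real CARD('n))"
    by (simp add: Bochner_Integration.integral_sum intF sum_divide_distrib)
  finally show ?thesis .
qed

lemma E_mono:
  assumes "determined_on (history m n k) F" "determined_on (history m n k) G" "\<And>i. F i \<le> G i"
  shows "E F \<le> E G"
  using assms by (intro integral_mono integrable_determined[OF finite_history history_subset])

end

subsection \<open>One step of the iteration\<close>

lemma norm_sq_vec: "(norm z)\<^sup>2 = (\<Sum>i\<in>UNIV. (norm (z $ i))\<^sup>2)"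
  for z :: "'b::real_inner ^ 'n::finite"
  by (simp add: power2_norm_eq_inner inner_vec_def)

lemma norm_sq_diff_scaleR:
  fixes x y :: "'a::real_inner"
  shows "(norm (x - t *\<^sub>R y))\<^sup>2 = (norm x)\<^sup>2 - 2 * t * inner x y + t\<^sup>2 * (norm y)\<^sup>2"
  unfolding power2_norm_eq_inner
  by (simp add: inner_diff inner_commute power2_eq_square algebra_simps)

lemma young_inner:
  fixes a b :: "'a::real_inner"
  assumes "s > 0"
  shows "2 * inner a b \<le> s * (norm a)\<^sup>2 + (norm b)\<^sup>2 / s"
proof -
  have "0 \<le> (norm (b - s *\<^sub>R a))\<^sup>2 / s"
    using assms by simp
  also have "\<dots> = (norm b)\<^sup>2 / s - 2 * inner a b + s * (norm a)\<^sup>2"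
    using assms by (simp add: norm_sq_diff_scaleR inner_commute field_simps power2_eq_square[of s])
  finally show ?thesis by simp
qed

lemma norm_diff_sq_le:
  fixes a b :: "'a::real_inner"
  shows "(norm (a - b))\<^sup>2 \<le> 2 * (norm a)\<^sup>2 + 2 * (norm b)\<^sup>2"
  using parallelogram[of a b] zero_le_power2[of "norm (a + b)"] by linarith

lemma norm_add_sq_le:
  fixes a b :: "'a::real_inner"
  shows "(norm (a + b))\<^sup>2 \<le> 2 * (norm a)\<^sup>2 + 2 * (norm b)\<^sup>2"
  using parallelogram[of a b] zero_le_power2[of "norm (a - b)"] by linarith

text \<open>The variance of a uniformly chosen \<open>f i\<close> is at most its second
  moment.\<close>

lemma sum_norm_sq_diff_mean:
  fixes f :: "'n::finite \<Rightarrow> 'a::real_inner"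
  shows "(\<Sum>i\<in>UNIV. (norm (f i - (1 / real CARD('n)) *\<^sub>R sum f UNIV))\<^sup>2) \<le> (\<Sum>i\<in>UNIV. (norm (f i))\<^sup>2)"
proof -
  define c where "c = (1 / real CARD('n)) *\<^sub>R sum f UNIV"
  have s: "sum f UNIV = real CARD('n) *\<^sub>R c" by (simp add: c_def)
  have "(\<Sum>i\<in>UNIV. (norm (f i - c))\<^sup>2)
      = (\<Sum>i\<in>UNIV. (norm (f i))\<^sup>2) - 2 * inner (sum f UNIV) c + real CARD('n) * inner c c"
    by (simp add: power2_norm_eq_inner inner_diff inner_commute sum.distrib sum_subtractf
        inner_sum_right sum_distrib_left)
  also have "\<dots> \<le> (\<Sum>i\<in>UNIV. (norm (f i))\<^sup>2)"
    by (simp add: s)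
  finally show ?thesis by (simp add: c_def)
qed

lemma mean_norm_sq_step:
  fixes h :: "'n::finite \<Rightarrow> 'a::real_inner"
  shows "(\<Sum>i\<in>UNIV. (norm (p - t *\<^sub>R h i))\<^sup>2) / real CARD('n)
    = (norm p)\<^sup>2 - 2 * t / real CARD('n) * inner p (sum h UNIV)
        + t\<^sup>2 / real CARD('n) * (\<Sum>i\<in>UNIV. (norm (h i))\<^sup>2)"
proof -
  have "(\<Sum>i\<in>UNIV. (norm (p - t *\<^sub>R h i))\<^sup>2)
      = real CARD('n) * (norm p)\<^sup>2 - 2 * t * inner p (sum h UNIV) + t\<^sup>2 * (\<Sum>i\<in>UNIV. (norm (h i))\<^sup>2)"
    by (simp add: norm_sq_diff_scaleR sum.distrib sum_subtractf inner_sum_right sum_distrib_left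
        mult.assoc)
  then show ?thesis by (simp add: add_divide_distrib diff_divide_distrib)
qed

locale operator_family =
  fixes A :: "'n::finite \<Rightarrow> 'a::{real_inner,complete_space} \<Rightarrow> 'b::real_inner"
  assumes bounded_linear_component: "bounded_linear (A i)"
begin

abbreviation L :: real where "L \<equiv> max_sq_norm A"

abbreviation T :: "'a \<Rightarrow> 'b ^ 'n" where "T \<equiv> stack A"

sublocale component: bounded_linear "A i" for i
  by (rule bounded_linear_component)

sublocale component_adjoint: bounded_linear "adjoint (A i)" for i
  by (intro bounded_linear_adjoint bounded_linear_component)

lemma bounded_linear_stack: "bounded_linear T"
proof -
  have "bounded_linear (\<lambda>x. \<Sum>i\<in>UNIV. axis i (A i x))"
  proof (intro bounded_linear_sum)
    fix i
    have "bounded_linear (axis i :: 'b \<Rightarrow> 'b ^ 'n)"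
    proof (rule bounded_linear_intro[where K = 1])
      show "norm (axis i z :: 'b ^ 'n) \<le> norm z * 1" for z :: 'b
        by (simp add: norm_eq_sqrt_inner inner_axis)
    qed (simp_all add: axis_def vec_eq_iff)
    then show "bounded_linear (\<lambda>x. axis i (A i x) :: 'b ^ 'n)"
      by (rule bounded_linear_compose) (rule bounded_linear_component)
  qed
  moreover have "T = (\<lambda>x. \<Sum>i\<in>UNIV. axis i (A i x))"
    by (auto simp: stack_def vec_eq_iff axis_def fun_eq_iff)
  ultimately show ?thesis by simp
qed

sublocale stack: bounded_linear T
  by (rule bounded_linear_stack)

sublocale stack_adjoint: bounded_linear "adjoint T"
  by (intro bounded_linear_adjoint bounded_linear_stack)

lemma inner_stack: "inner (T x) z = inner x (adjoint T z)"
  by (rule inner_adjoint[OF bounded_linear_stack])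

lemma adjoint_stack: "adjoint T z = (\<Sum>i\<in>UNIV. adjoint (A i) (z $ i))"
proof -
  have "inner x (adjoint T z) = inner x (\<Sum>i\<in>UNIV. adjoint (A i) (z $ i))" for x
    unfolding inner_stack[symmetric] inner_vec_def inner_sum_right
    by (simp add: stack_def inner_adjoint[OF bounded_linear_component])
  then show ?thesis by (metis vector_eq_rdot inner_commute)
qed

lemma norm_adjoint_stack_sq: "(norm (adjoint T z))\<^sup>2 \<le> (onorm T)\<^sup>2 * (norm z)\<^sup>2"
  using power_mono[OF norm_adjoint_le[OF bounded_linear_stack] norm_ge_zero, of z 2]
  by (simp add: power_mult_distrib)

lemma norm_component_adjoint_sq: "(norm (adjoint (A i) z))\<^sup>2 \<le> L * (norm z)\<^sup>2"
proof -
  have "(norm (adjoint (A i) z))\<^sup>2 \<le> (onorm (A i))\<^sup>2 * (norm z)\<^sup>2"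
    using power_mono[OF norm_adjoint_le[OF bounded_linear_component] norm_ge_zero, of i z 2]
    by (simp add: power_mult_distrib)
  also have "\<dots> \<le> L * (norm z)\<^sup>2"
    unfolding max_sq_norm_def by (intro mult_right_mono Max_ge) auto
  finally show ?thesis .
qed

section \<open>Energy balance of a single step\<close>

text \<open>The update direction for data \<open>w\<close>, anchor \<open>x\<close> and current
  point \<open>p\<close>, with the drawn index as a parameter so that it can be averaged.\<close>

definition direction :: "'b ^ 'n \<Rightarrow> 'a \<Rightarrow> 'a \<Rightarrow> 'n \<Rightarrow> 'a" where
  "direction w x p a = adjoint (A a) (A a (p - x)) + (1 / real CARD('n)) *\<^sub>R full_gradient A w x"

text \<open>Unbiasedness: the anchor contributions cancel in the sum, which leaves the full gradient
  at the current point.\<close>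

lemma sum_direction: "(\<Sum>a\<in>UNIV. direction w x p a) = adjoint T (T p - w)"
proof -
  have "(\<Sum>a\<in>UNIV. adjoint (A a) (A a (p - x))) = adjoint T (T (p - x))"
    by (simp add: adjoint_stack stack_def)
  then show ?thesis
    by (simp add: direction_def full_gradient_def sum.distrib stack.diff stack_adjoint.diff
        sum_constant_scaleR)
qed

text \<open>The direction is the component gradient at \<open>p\<close> minus the centred component
  gradient at \<open>x\<close>. The square of the difference splits with factor 2, and centring does
  not increase the second moment.\<close>

lemma sum_norm_sq_direction:
  "(\<Sum>a\<in>UNIV. (norm (direction w x p a))\<^sup>2)
    \<le> 2 * L * (norm (T p - w))\<^sup>2 + 2 * L * (norm (T x - w))\<^sup>2"
proof -
  define f where "f z a = adjoint (A a) ((T z - w) $ a)" for z a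
  have sum_f: "sum (f z) UNIV = full_gradient A w z" for z
    by (simp add: f_def full_gradient_def adjoint_stack)
  have f_le: "(\<Sum>a\<in>UNIV. (norm (f z a))\<^sup>2) \<le> L * (norm (T z - w))\<^sup>2" for z
    unfolding norm_sq_vec[of "T z - w"] sum_distrib_left f_def
    by (intro sum_mono norm_component_adjoint_sq)
  have split: "direction w x p a = f p a - (f x a - (1 / real CARD('n)) *\<^sub>R sum (f x) UNIV)" for a
    unfolding sum_f by (simp add: direction_def f_def stack_def component.diff component_adjoint.diff)
  have "(\<Sum>a\<in>UNIV. (norm (direction w x p a))\<^sup>2)
      \<le> (\<Sum>a\<in>UNIV. 2 * (norm (f p a))\<^sup>2 + 2 * (norm (f x a - (1 / real CARD('n)) *\<^sub>R sum (f x) UNIV))\<^sup>2)"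
    unfolding split by (intro sum_mono norm_diff_sq_le)
  also have "\<dots> = 2 * (\<Sum>a\<in>UNIV. (norm (f p a))\<^sup>2)
      + 2 * (\<Sum>a\<in>UNIV. (norm (f x a - (1 / real CARD('n)) *\<^sub>R sum (f x) UNIV))\<^sup>2)"
    by (simp add: sum.distrib sum_distrib_left)
  also have "\<dots> \<le> 2 * (L * (norm (T p - w))\<^sup>2) + 2 * (L * (norm (T x - w))\<^sup>2)"
    using f_le[of p] f_le[of x] sum_norm_sq_diff_mean[of "f x"] by simp
  finally show ?thesis by simp
qed

text \<open>Here \<open>x\<close> is an error and \<open>w\<close> the noise. Pairing
  \<open>T x\<close> with the residual r = \<open>T x - w\<close> gives the decrease plus a cross
  term of \<open>w\<close> with r, absorbed by Young's inequality at the price of \<kappa> in the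
  decrease.\<close>

lemma gradient_step_energy:
  assumes \<gamma>: "\<gamma> > 0" and \<kappa>: "\<kappa> > 0"
  shows "(norm (x - \<gamma> *\<^sub>R full_gradient A w x))\<^sup>2
    \<le> (norm x)\<^sup>2 - (2 * \<gamma> - \<gamma>\<^sup>2 * (onorm T)\<^sup>2 - \<kappa>) * (norm (T x - w))\<^sup>2
        + \<gamma>\<^sup>2 / \<kappa> * (norm w)\<^sup>2"
proof -
  define r where "r = T x - w"
  have Tx: "T x = r + w" by (simp add: r_def)
  have "(norm (x - \<gamma> *\<^sub>R adjoint T r))\<^sup>2
      = (norm x)\<^sup>2 - 2 * \<gamma> * inner (T x) r + \<gamma>\<^sup>2 * (norm (adjoint T r))\<^sup>2"
    by (simp add: inner_stack norm_sq_diff_scaleR)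
  also have "inner (T x) r = (norm r)\<^sup>2 + inner w r"
    by (simp add: Tx inner_add power2_norm_eq_inner)
  finally have eq: "(norm (x - \<gamma> *\<^sub>R adjoint T r))\<^sup>2
      = (norm x)\<^sup>2 - 2 * \<gamma> * (norm r)\<^sup>2 - 2 * \<gamma> * inner w r + \<gamma>\<^sup>2 * (norm (adjoint T r))\<^sup>2"
    by (simp add: algebra_simps)
  have "- 2 * \<gamma> * inner w r = \<gamma> * (2 * inner r (- w))"
    by (simp add: inner_commute)
  \<comment> \<open>The weight is chosen so that, after multiplication by \<gamma>, the residual
    appears with factor exactly \<kappa>.\<close>
  also have "\<dots> \<le> \<gamma> * (\<kappa> / \<gamma> * (norm r)\<^sup>2 + (norm (- w))\<^sup>2 / (\<kappa> / \<gamma>))"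
    by (intro mult_left_mono young_inner) (use \<gamma> \<kappa> in auto)
  also have "\<dots> = \<kappa> * (norm r)\<^sup>2 + \<gamma>\<^sup>2 / \<kappa> * (norm w)\<^sup>2"
    using \<gamma> \<kappa> by (simp add: field_simps power2_eq_square)
  finally have "- 2 * \<gamma> * inner w r \<le> \<kappa> * (norm r)\<^sup>2 + \<gamma>\<^sup>2 / \<kappa> * (norm w)\<^sup>2" .
  moreover have "\<gamma>\<^sup>2 * (norm (adjoint T r))\<^sup>2 \<le> \<gamma>\<^sup>2 * ((onorm T)\<^sup>2 * (norm r)\<^sup>2)"
    by (intro mult_left_mono norm_adjoint_stack_sq) simp
  ultimately show ?thesis
    unfolding full_gradient_def r_def[symmetric] eq by (simp add: algebra_simps)
qed

text \<open>With \<eta> = 1 - \<gamma> L, the cross term and the second moment together leave a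
  decrease of 2 \<gamma> \<eta> / N times the squared residual at \<open>p\<close>. Young's
  inequality with weight \<eta> spends half of it on the noise.\<close>

lemma inner_step_energy:
  assumes \<gamma>: "\<gamma> > 0" and step: "\<gamma> * L < 1"
  shows "(\<Sum>a\<in>UNIV. (norm (p - \<gamma> *\<^sub>R direction w x p a))\<^sup>2) / real CARD('n)
    \<le> (norm p)\<^sup>2 - \<gamma> / real CARD('n) * (1 - \<gamma> * L) * (norm (T p - w))\<^sup>2
        + 2 * \<gamma>\<^sup>2 * L / real CARD('n) * (norm (T x - w))\<^sup>2 + \<gamma> / (real CARD('n) * (1 - \<gamma> * L)) * (norm w)\<^sup>2"
proof -
  define s where "s = T p - w"
  define \<eta> where "\<eta> = 1 - \<gamma> * L"
  have \<eta>: "\<eta> > 0" and \<gamma>L: "\<gamma> * L = 1 - \<eta>" using step by (auto simp: \<eta>_def)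
  define t where "t = \<gamma> / real CARD('n)"
  have scale: "\<gamma> / real CARD('n) = t" "2 * \<gamma> / real CARD('n) = 2 * t"
    "\<gamma> / (real CARD('n) * \<eta>) = t / \<eta>"
    by (simp_all add: t_def)
  have Tp: "T p = s + w" by (simp add: s_def)
  have inner: "inner p (sum (direction w x p) UNIV) = (norm s)\<^sup>2 + inner w s"
    unfolding sum_direction inner_stack[symmetric] s_def[symmetric]
    by (simp add: Tp inner_add power2_norm_eq_inner)
  have "- 2 * inner w s = 2 * inner s (- w)"
    by (simp add: inner_commute)
  also have "\<dots> \<le> \<eta> * (norm s)\<^sup>2 + (norm (- w))\<^sup>2 / \<eta>"
    by (rule young_inner[OF \<eta>])
  finally have "t * (- 2 * inner w s) \<le> t * (\<eta> * (norm s)\<^sup>2 + (norm w)\<^sup>2 / \<eta>)"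
    using \<gamma> by (intro mult_left_mono) (auto simp: t_def)
  moreover have "\<gamma>\<^sup>2 / real CARD('n) * (\<Sum>a\<in>UNIV. (norm (direction w x p a))\<^sup>2)
      \<le> \<gamma>\<^sup>2 / real CARD('n) * (2 * L * (norm s)\<^sup>2 + 2 * L * (norm (T x - w))\<^sup>2)"
    unfolding s_def by (intro mult_left_mono sum_norm_sq_direction) simp
  moreover have "\<gamma>\<^sup>2 / real CARD('n) * (2 * L * (norm s)\<^sup>2 + 2 * L * (norm (T x - w))\<^sup>2)
      = 2 * t * (1 - \<eta>) * (norm s)\<^sup>2 + 2 * \<gamma>\<^sup>2 * L / real CARD('n) * (norm (T x - w))\<^sup>2"
    unfolding \<gamma>L[symmetric] t_def by (simp add: power2_eq_square algebra_simps)
  ultimately show ?thesis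
    unfolding mean_norm_sq_step inner s_def[symmetric] \<eta>_def[symmetric] scale
    by (simp add: algebra_simps)
qed

end

subsection \<open>Energy estimate\<close>

lemma svrg_inner_cong:
  "(\<And>l. l < k \<Longrightarrow> i l = j l) \<Longrightarrow> svrg_inner A y \<gamma>\<^sub>0 \<gamma>\<^sub>1 x i k = svrg_inner A y \<gamma>\<^sub>0 \<gamma>\<^sub>1 x j k"
  by (induction k) auto

lemma svrg_cong:
  assumes "\<And>n' k. n' < n \<Longrightarrow> k < m \<Longrightarrow> i n' k = j n' k"
  shows "svrg A y \<gamma>\<^sub>0 \<gamma>\<^sub>1 m x i n = svrg A y \<gamma>\<^sub>0 \<gamma>\<^sub>1 m x j n"
  using assms by (induction n) (auto intro: svrg_inner_cong)

lemma determined_on_svrg: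
  "determined_on (history m n k) (\<lambda>i. svrg A y \<gamma>\<^sub>0 \<gamma>\<^sub>1 m x i n)"
  unfolding determined_on_def by (auto simp: history_def intro!: svrg_cong)

lemma determined_on_svrg_inner:
  assumes "k \<le> m"
  shows "determined_on (history m n k) (\<lambda>i. svrg_inner A y \<gamma>\<^sub>0 \<gamma>\<^sub>1 (svrg A y \<gamma>\<^sub>0 \<gamma>\<^sub>1 m x i n) (i n) k)"
  unfolding determined_on_def
proof (intro allI impI)
  fix i j :: "nat \<Rightarrow> nat \<Rightarrow> 'a"
  assume eq: "\<forall>(n, k)\<in>history m n k. i n k = j n k"
  have "svrg A y \<gamma>\<^sub>0 \<gamma>\<^sub>1 m x i n = svrg A y \<gamma>\<^sub>0 \<gamma>\<^sub>1 m x j n"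
    using eq by (intro svrg_cong) (auto simp: history_def)
  moreover have "svrg_inner A y \<gamma>\<^sub>0 \<gamma>\<^sub>1 z (i n) k = svrg_inner A y \<gamma>\<^sub>0 \<gamma>\<^sub>1 z (j n) k" for z
    using eq assms by (intro svrg_inner_cong) (auto simp: history_def)
  ultimately show "svrg_inner A y \<gamma>\<^sub>0 \<gamma>\<^sub>1 (svrg A y \<gamma>\<^sub>0 \<gamma>\<^sub>1 m x i n) (i n) k
      = svrg_inner A y \<gamma>\<^sub>0 \<gamma>\<^sub>1 (svrg A y \<gamma>\<^sub>0 \<gamma>\<^sub>1 m x j n) (j n) k"
    by simp
qed

context uniform_indices begin

text \<open>The tower property as used for every inner step: a bound on the average over the fresh
  index, valid for each fixed past, passes to expectations.\<close>

lemma expectation_step_le: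
  fixes F :: "'n \<Rightarrow> (nat \<Rightarrow> nat \<Rightarrow> 'n) \<Rightarrow> real"
  assumes k: "k < m" and F: "\<And>a. determined_on (history m n k) (F a)"
    and G: "determined_on (history m n k) G"
    and le: "\<And>i. (\<Sum>a\<in>UNIV. F a i) / real CARD('n) \<le> G i"
  shows "E (\<lambda>i. F (i n k) i) \<le> E G"
proof -
  have "determined_on (history m n k) (\<lambda>i. (\<Sum>a\<in>UNIV. F a i) / real CARD('n))"
    using F unfolding determined_on_def by (metis (no_types, lifting) sum.cong)
  then have "E (\<lambda>i. (\<Sum>a\<in>UNIV. F a i) / real CARD('n)) \<le> E G"
    using G le by (rule E_mono)
  then show ?thesis
    using expectation_average[where F = F,
        OF finite_history history_subset current_notin_history k F] by simp
qed

lemma integrable_history: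
  "determined_on (history m n k) F \<Longrightarrow> integrable M (\<lambda>\<omega>. F (\<lambda>n k. idx n k \<omega>) :: real)"
  by (rule integrable_determined[OF finite_history history_subset])

text \<open>The common shape of the energy bounds; shorter ones are padded with zero coefficients,
  whence summands such as \<open>0 * ?r i\<close>.\<close>

lemma E_linear:
  assumes "determined_on (history m n k) F" "determined_on (history m n k) G"
    "determined_on (history m n k) H"
  shows "E (\<lambda>i. F i + a * G i + b * H i + c) = E F + a * E G + b * E H + c"
  using assms by (simp add: integrable_history prob_space)

end

locale svrg_iteration = operator_family A + uniform_indices M idx m
  for A :: "'n::finite \<Rightarrow> 'a::{real_inner,complete_space} \<Rightarrow> 'b::real_inner"
    and M :: "'w measure" and idx :: "nat \<Rightarrow> nat \<Rightarrow> 'w \<Rightarrow> 'n" and m :: nat +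
  fixes \<gamma>\<^sub>0 \<gamma>\<^sub>1 :: real
  assumes \<gamma>\<^sub>0_pos: "\<gamma>\<^sub>0 > 0" and \<gamma>\<^sub>1_pos: "\<gamma>\<^sub>1 > 0"
    and inner_step_size: "\<gamma>\<^sub>1 * L < 1"
    and outer_step_size:
      "2 * \<gamma>\<^sub>0 - \<gamma>\<^sub>0\<^sup>2 * (onorm T)\<^sup>2 - 2 * real m * \<gamma>\<^sub>1\<^sup>2 * L / real CARD('n) > 0"
begin

section \<open>Energy balance over an epoch\<close>

text \<open>Half the slack in the outer step-size condition: one half pays for the noise in the
  gradient step, the other survives as decrease.\<close>

definition \<kappa> :: real where
  "\<kappa> = (2 * \<gamma>\<^sub>0 - \<gamma>\<^sub>0\<^sup>2 * (onorm T)\<^sup>2 - 2 * real m * \<gamma>\<^sub>1\<^sup>2 * L / real CARD('n)) / 2"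

definition \<tau> :: real where "\<tau> = \<gamma>\<^sub>1 / real CARD('n) * (1 - \<gamma>\<^sub>1 * L)"

definition noise_const :: real where
  "noise_const = \<gamma>\<^sub>0\<^sup>2 / \<kappa> + real m * (\<gamma>\<^sub>1 / (real CARD('n) * (1 - \<gamma>\<^sub>1 * L)))"

lemma \<kappa>_pos: "\<kappa> > 0"
  using outer_step_size by (simp add: \<kappa>_def)

lemma \<tau>_pos: "\<tau> > 0"
  using \<gamma>\<^sub>1_pos inner_step_size by (simp add: \<tau>_def)

abbreviation outer :: "'b ^ 'n \<Rightarrow> 'a \<Rightarrow> nat \<Rightarrow> (nat \<Rightarrow> nat \<Rightarrow> 'n) \<Rightarrow> 'a" where
  "outer w x n i \<equiv> svrg A w \<gamma>\<^sub>0 \<gamma>\<^sub>1 m x i n"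

abbreviation inner_it :: "'b ^ 'n \<Rightarrow> 'a \<Rightarrow> nat \<Rightarrow> nat \<Rightarrow> (nat \<Rightarrow> nat \<Rightarrow> 'n) \<Rightarrow> 'a" where
  "inner_it w x n k i \<equiv> svrg_inner A w \<gamma>\<^sub>0 \<gamma>\<^sub>1 (outer w x n i) (i n) k"

definition energy :: "'b ^ 'n \<Rightarrow> 'a \<Rightarrow> nat \<Rightarrow> real" where
  "energy w x n = E (\<lambda>i. (norm (outer w x n i))\<^sup>2)"

definition inner_energy :: "'b ^ 'n \<Rightarrow> 'a \<Rightarrow> nat \<Rightarrow> nat \<Rightarrow> real" where
  "inner_energy w x n k = E (\<lambda>i. (norm (inner_it w x n k i))\<^sup>2)"

definition residual :: "'b ^ 'n \<Rightarrow> 'a \<Rightarrow> nat \<Rightarrow> real" where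
  "residual w x n = E (\<lambda>i. (norm (T (outer w x n i) - w))\<^sup>2)"

definition inner_residual :: "'b ^ 'n \<Rightarrow> 'a \<Rightarrow> nat \<Rightarrow> nat \<Rightarrow> real" where
  "inner_residual w x n k = E (\<lambda>i. (norm (T (inner_it w x n k i) - w))\<^sup>2)"

lemma determined_outer: "determined_on (history m n k) (\<lambda>i. f (outer w x n i))"
  by (rule determined_on_comp[OF determined_on_svrg])

lemma determined_inner: "k \<le> m \<Longrightarrow> determined_on (history m n k) (\<lambda>i. f (inner_it w x n k i))"
  by (rule determined_on_comp[OF determined_on_svrg_inner])

lemma determined_inner_outer:
  "k \<le> m \<Longrightarrow> determined_on (history m n k) (\<lambda>i. f (inner_it w x n k i) (outer w x n i))"
  by (rule determined_on_comp2[OF determined_on_svrg_inner determined_on_svrg])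

lemma residual_nonneg: "0 \<le> residual w x n" "0 \<le> inner_residual w x n k"
  by (simp_all add: residual_def inner_residual_def)

lemma energy_nonneg: "0 \<le> energy w x n"
  by (simp add: energy_def)

lemma inner_energy_0:
  "inner_energy w x n 0 \<le> energy w x n
    - (2 * \<gamma>\<^sub>0 - \<gamma>\<^sub>0\<^sup>2 * (onorm T)\<^sup>2 - \<kappa>) * residual w x n + \<gamma>\<^sub>0\<^sup>2 / \<kappa> * (norm w)\<^sup>2"
proof -
  let ?e = "\<lambda>i. (norm (outer w x n i))\<^sup>2" and ?r = "\<lambda>i. (norm (T (outer w x n i) - w))\<^sup>2"
  let ?c = "2 * \<gamma>\<^sub>0 - \<gamma>\<^sub>0\<^sup>2 * (onorm T)\<^sup>2 - \<kappa>" and ?d = "\<gamma>\<^sub>0\<^sup>2 / \<kappa> * (norm w)\<^sup>2"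
  have "inner_energy w x n 0 \<le> E (\<lambda>i. ?e i + (- ?c) * ?r i + 0 * ?r i + ?d)"
    unfolding inner_energy_def svrg_inner.simps
  proof (rule E_mono[where n = n and k = 0])
    show "(norm (outer w x n i - \<gamma>\<^sub>0 *\<^sub>R full_gradient A w (outer w x n i)))\<^sup>2
        \<le> ?e i + (- ?c) * ?r i + 0 * ?r i + ?d" for i
      using gradient_step_energy[OF \<gamma>\<^sub>0_pos \<kappa>_pos, of "outer w x n i" w]
      unfolding mult_minus_left by simp
  qed (rule determined_outer)+
  also have "\<dots> = E ?e + (- ?c) * E ?r + 0 * E ?r + ?d"
    by (rule E_linear[where F = ?e and G = ?r and H = ?r]) (rule determined_outer)+
  finally show ?thesis
    unfolding mult_minus_left by (simp add: energy_def residual_def)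
qed

lemma inner_energy_Suc:
  assumes k: "k < m"
  shows "inner_energy w x n (Suc k) \<le> inner_energy w x n k - \<tau> * inner_residual w x n k
    + 2 * \<gamma>\<^sub>1\<^sup>2 * L / real CARD('n) * residual w x n
    + \<gamma>\<^sub>1 / (real CARD('n) * (1 - \<gamma>\<^sub>1 * L)) * (norm w)\<^sup>2"
proof -
  let ?e = "\<lambda>i. (norm (inner_it w x n k i))\<^sup>2"
    and ?r' = "\<lambda>i. (norm (T (inner_it w x n k i) - w))\<^sup>2"
    and ?r = "\<lambda>i. (norm (T (outer w x n i) - w))\<^sup>2"
  let ?c = "2 * \<gamma>\<^sub>1\<^sup>2 * L / real CARD('n)"
    and ?d = "\<gamma>\<^sub>1 / (real CARD('n) * (1 - \<gamma>\<^sub>1 * L)) * (norm w)\<^sup>2"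
  let ?F = "\<lambda>a i. (norm (inner_it w x n k i
      - \<gamma>\<^sub>1 *\<^sub>R direction w (outer w x n i) (inner_it w x n k i) a))\<^sup>2"
  have km: "k \<le> m" using k by simp
  have "inner_energy w x n (Suc k) = E (\<lambda>i. ?F (i n k) i)"
    by (simp add: inner_energy_def direction_def)
  also have "\<dots> \<le> E (\<lambda>i. ?e i + (- \<tau>) * ?r' i + ?c * ?r i + ?d)"
  proof (rule expectation_step_le[where F = ?F
        and G = "\<lambda>i. ?e i + (- \<tau>) * ?r' i + ?c * ?r i + ?d", OF k])
    show "(\<Sum>a\<in>UNIV. ?F a i) / real CARD('n) \<le> ?e i + (- \<tau>) * ?r' i + ?c * ?r i + ?d" for i
      using inner_step_energy[OF \<gamma>\<^sub>1_pos inner_step_size, of "inner_it w x n k i" w "outer w x n i"]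
      by (simp add: \<tau>_def)
  qed (rule determined_inner_outer[OF km])+
  also have "\<dots> = E ?e + (- \<tau>) * E ?r' + ?c * E ?r + ?d"
    by (rule E_linear[where F = ?e and G = ?r' and H = ?r])
      (rule determined_outer determined_inner[OF km])+
  finally show ?thesis by (simp add: inner_energy_def inner_residual_def residual_def)
qed

text \<open>Adds up the inner steps of an epoch. Each raises the energy by a multiple of the anchor
  residual, and the decrease of the gradient step covers all \<open>m\<close> of these.\<close>

lemma energy_Suc:
  "energy w x (Suc n) \<le> energy w x n - \<kappa> * residual w x n
    - \<tau> * (\<Sum>k<m. inner_residual w x n k) + noise_const * (norm w)\<^sup>2"
proof -
  define d where "d = 2 * \<gamma>\<^sub>1\<^sup>2 * L / real CARD('n) * residual w x n
      + \<gamma>\<^sub>1 / (real CARD('n) * (1 - \<gamma>\<^sub>1 * L)) * (norm w)\<^sup>2"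
  have "inner_energy w x n k \<le> inner_energy w x n 0 - \<tau> * (\<Sum>l<k. inner_residual w x n l)
      + real k * d" if "k \<le> m" for k
    using that
  proof (induction k)
    case (Suc k)
    then have "inner_energy w x n (Suc k) \<le> inner_energy w x n k - \<tau> * inner_residual w x n k + d"
      using inner_energy_Suc[of k w x n] by (simp add: d_def)
    with Suc show ?case by (simp add: algebra_simps)
  qed simp
  from this[of m] have "energy w x (Suc n) \<le> inner_energy w x n 0
      - \<tau> * (\<Sum>l<m. inner_residual w x n l) + real m * d"
    by (simp add: energy_def inner_energy_def)
  \<comment> \<open>The second summand on the right pays for the anchor terms of the
    \<open>m\<close> inner steps, so exactly \<kappa> remains.\<close>
  moreover have "2 * \<gamma>\<^sub>0 - \<gamma>\<^sub>0\<^sup>2 * (onorm T)\<^sup>2 - \<kappa> = \<kappa> + real m * (2 * \<gamma>\<^sub>1\<^sup>2 * L / real CARD('n))"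
    by (simp add: \<kappa>_def field_simps)
  ultimately show ?thesis
    using inner_energy_0[of w x n] by (simp add: noise_const_def d_def distrib_left distrib_right mult.assoc)
qed

text \<open>Dropping the residuals leaves one noise contribution per epoch. This linear growth is
  why the stopping rule asks for \<delta>^2 times the number of epochs to vanish.\<close>

lemma energy_le: "energy w x n \<le> (norm x)\<^sup>2 + real n * (noise_const * (norm w)\<^sup>2)"
proof (induction n)
  case (Suc n)
  have "0 \<le> \<kappa> * residual w x n" "0 \<le> \<tau> * (\<Sum>k<m. inner_residual w x n k)"
    using \<kappa>_pos \<tau>_pos by (simp_all add: residual_nonneg sum_nonneg)
  with Suc energy_Suc[of w x n] show ?case
    by (simp add: algebra_simps)
qed (simp add: energy_def prob_space)

end

subsection \<open>Superposition and source conditions\<close>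

text \<open>
  The iteration lifted along the adjoint: started at \<open>v\<close>, it yields preimages under the adjoint
  of the noise-free iterates started at \<open>adjoint (stack A) v\<close>.
\<close>

primrec lift_inner ::
    "('n::finite \<Rightarrow> 'a::real_inner \<Rightarrow> 'b::real_inner) \<Rightarrow> real \<Rightarrow> real \<Rightarrow> 'b ^ 'n
      \<Rightarrow> (nat \<Rightarrow> 'n) \<Rightarrow> nat \<Rightarrow> 'b ^ 'n" where
  "lift_inner A \<gamma>\<^sub>0 \<gamma>\<^sub>1 v j 0 = v - \<gamma>\<^sub>0 *\<^sub>R stack A (adjoint (stack A) v)"
| "lift_inner A \<gamma>\<^sub>0 \<gamma>\<^sub>1 v j (Suc k) =
     lift_inner A \<gamma>\<^sub>0 \<gamma>\<^sub>1 v j k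
       - \<gamma>\<^sub>1 *\<^sub>R (axis (j k) (A (j k) (adjoint (stack A) (lift_inner A \<gamma>\<^sub>0 \<gamma>\<^sub>1 v j k)
                                  - adjoint (stack A) v))
                + (1 / real CARD('n)) *\<^sub>R stack A (adjoint (stack A) v))"

primrec lift_outer ::
    "('n::finite \<Rightarrow> 'a::real_inner \<Rightarrow> 'b::real_inner) \<Rightarrow> real \<Rightarrow> real \<Rightarrow> nat \<Rightarrow> 'b ^ 'n
      \<Rightarrow> (nat \<Rightarrow> nat \<Rightarrow> 'n) \<Rightarrow> nat \<Rightarrow> 'b ^ 'n" where
  "lift_outer A \<gamma>\<^sub>0 \<gamma>\<^sub>1 m v i 0 = v"
| "lift_outer A \<gamma>\<^sub>0 \<gamma>\<^sub>1 m v i (Suc n) =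
     lift_inner A \<gamma>\<^sub>0 \<gamma>\<^sub>1 (lift_outer A \<gamma>\<^sub>0 \<gamma>\<^sub>1 m v i n) (i n) m"

lemma lift_inner_cong:
  "(\<And>l. l < k \<Longrightarrow> i l = j l) \<Longrightarrow> lift_inner A \<gamma>\<^sub>0 \<gamma>\<^sub>1 v i k = lift_inner A \<gamma>\<^sub>0 \<gamma>\<^sub>1 v j k"
  by (induction k) auto

lemma lift_outer_cong:
  assumes "\<And>n' k. n' < n \<Longrightarrow> k < m \<Longrightarrow> i n' k = j n' k"
  shows "lift_outer A \<gamma>\<^sub>0 \<gamma>\<^sub>1 m v i n = lift_outer A \<gamma>\<^sub>0 \<gamma>\<^sub>1 m v j n"
  using assms by (induction n) (auto intro: lift_inner_cong)

lemma determined_on_lift_outer: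
  "determined_on (history m n k) (\<lambda>i. lift_outer A \<gamma>\<^sub>0 \<gamma>\<^sub>1 m v i n)"
  unfolding determined_on_def by (auto simp: history_def intro!: lift_outer_cong)

lemma determined_on_lift_inner:
  assumes "k \<le> m"
  shows "determined_on (history m n k) (\<lambda>i. lift_inner A \<gamma>\<^sub>0 \<gamma>\<^sub>1 (lift_outer A \<gamma>\<^sub>0 \<gamma>\<^sub>1 m v i n) (i n) k)"
  unfolding determined_on_def
proof (intro allI impI)
  fix i j :: "nat \<Rightarrow> nat \<Rightarrow> 'a"
  assume eq: "\<forall>(n, k)\<in>history m n k. i n k = j n k"
  have "lift_outer A \<gamma>\<^sub>0 \<gamma>\<^sub>1 m v i n = lift_outer A \<gamma>\<^sub>0 \<gamma>\<^sub>1 m v j n"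
    using eq by (intro lift_outer_cong) (auto simp: history_def)
  moreover have "lift_inner A \<gamma>\<^sub>0 \<gamma>\<^sub>1 z (i n) k = lift_inner A \<gamma>\<^sub>0 \<gamma>\<^sub>1 z (j n) k" for z
    using eq assms by (intro lift_inner_cong) (auto simp: history_def)
  ultimately show "lift_inner A \<gamma>\<^sub>0 \<gamma>\<^sub>1 (lift_outer A \<gamma>\<^sub>0 \<gamma>\<^sub>1 m v i n) (i n) k
      = lift_inner A \<gamma>\<^sub>0 \<gamma>\<^sub>1 (lift_outer A \<gamma>\<^sub>0 \<gamma>\<^sub>1 m v j n) (j n) k"
    by simp
qed

context operator_family begin

lemma full_gradient_add: "full_gradient A (y + z) (x + u) = full_gradient A y x + full_gradient A z u"
  by (simp add: full_gradient_def stack.add stack_adjoint.add stack_adjoint.diff)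

text \<open>For fixed indices each step is jointly linear in data, anchor and current iterate; this
  permits splitting the error.\<close>

lemma svrg_inner_add:
  "svrg_inner A (y + z) \<gamma>\<^sub>0 \<gamma>\<^sub>1 (x + u) j k
    = svrg_inner A y \<gamma>\<^sub>0 \<gamma>\<^sub>1 x j k + svrg_inner A z \<gamma>\<^sub>0 \<gamma>\<^sub>1 u j k"
proof -
  define s t where "s = x + u" and "t = y + z"
  have s: "s = x + u" "A i s = A i x + A i u"
    and grad: "full_gradient A t s = full_gradient A y x + full_gradient A z u" for i
    by (simp_all add: s_def t_def full_gradient_add component.add)
  have "svrg_inner A t \<gamma>\<^sub>0 \<gamma>\<^sub>1 s j k
      = svrg_inner A y \<gamma>\<^sub>0 \<gamma>\<^sub>1 x j k + svrg_inner A z \<gamma>\<^sub>0 \<gamma>\<^sub>1 u j k"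
  proof (induction k)
    case 0
    then show ?case by (simp add: grad scaleR_add_right) (simp add: s(1))
  next
    case (Suc k)
    then show ?case
      by (simp add: grad s(2) component.add component.diff component_adjoint.add
          component_adjoint.diff scaleR_add_right scaleR_diff_right)
  qed
  then show ?thesis by (simp only: s_def t_def)
qed

lemma svrg_add:
  "svrg A (y + z) \<gamma>\<^sub>0 \<gamma>\<^sub>1 m (x + u) i n = svrg A y \<gamma>\<^sub>0 \<gamma>\<^sub>1 m x i n + svrg A z \<gamma>\<^sub>0 \<gamma>\<^sub>1 m u i n"
  by (induction n) (simp_all add: svrg_inner_add)

text \<open>At an exact solution the full gradient vanishes, and with it every correction. Together
  with superposition this recentres the error at 0.\<close>

lemma svrg_inner_solution: "svrg_inner A (T x) \<gamma>\<^sub>0 \<gamma>\<^sub>1 x j k = x"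
  by (induction k)
    (simp_all add: full_gradient_def stack_adjoint.zero component.zero component_adjoint.zero)

lemma svrg_solution: "svrg A (T x) \<gamma>\<^sub>0 \<gamma>\<^sub>1 m x i n = x"
  by (induction n) (simp_all add: svrg_inner_solution)

lemma adjoint_stack_axis: "adjoint T (axis a z) = adjoint (A a) z"
proof -
  have "adjoint T (axis a z) = (\<Sum>i\<in>UNIV. if i = a then adjoint (A a) z else 0)"
    unfolding adjoint_stack by (intro sum.cong) (auto simp: axis_def component_adjoint.zero)
  then show ?thesis by simp
qed

text \<open>\<open>adjoint T\<close> commutes with each step; for the stochastic term this holds
  because \<open>adjoint (A a)\<close> is \<open>adjoint T\<close> on vectors supported in slot
  \<open>a\<close>.\<close>

lemma svrg_inner_lift:
  "svrg_inner A 0 \<gamma>\<^sub>0 \<gamma>\<^sub>1 (adjoint T v) j k = adjoint T (lift_inner A \<gamma>\<^sub>0 \<gamma>\<^sub>1 v j k)"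
  by (induction k)
    (simp_all add: full_gradient_def stack_adjoint.diff stack_adjoint.add stack_adjoint.scaleR
      adjoint_stack_axis)

lemma svrg_lift:
  "svrg A 0 \<gamma>\<^sub>0 \<gamma>\<^sub>1 m (adjoint T v) i n = adjoint T (lift_outer A \<gamma>\<^sub>0 \<gamma>\<^sub>1 m v i n)"
  by (induction n) (simp_all add: svrg_inner_lift)

section \<open>Steps of the lifted iteration\<close>

text \<open>A preimage under \<open>adjoint T\<close> of \<open>direction\<close> for zero data,
  anchor \<open>adjoint T v\<close> and current point \<open>adjoint T u\<close>.\<close>

definition lift_direction :: "'b ^ 'n \<Rightarrow> 'b ^ 'n \<Rightarrow> 'n \<Rightarrow> 'b ^ 'n" where
  "lift_direction v u a = axis a (A a (adjoint T u - adjoint T v))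
    + (1 / real CARD('n)) *\<^sub>R T (adjoint T v)"

lemma norm_sq_axis: "(norm (axis a z :: 'b ^ 'n))\<^sup>2 = (norm z)\<^sup>2"
  by (simp add: power2_norm_eq_inner inner_axis)

lemma sum_axis: "(\<Sum>a\<in>UNIV. axis a (f a :: 'b)) = (\<chi> a. f a)"
  by (simp add: vec_eq_iff axis_def)

text \<open>The directions sum to \<open>T (adjoint T u)\<close>, a positive semidefinite operator
  applied to \<open>u\<close>, so the cross term only lowers the norm and is dropped. Growth comes
  from the second moment alone.\<close>

lemma lift_step_energy:
  assumes \<gamma>: "\<gamma> \<ge> 0"
  shows "(\<Sum>a\<in>UNIV. (norm (u - \<gamma> *\<^sub>R lift_direction v u a))\<^sup>2) / real CARD('n)
    \<le> (norm u)\<^sup>2 + 6 * \<gamma>\<^sup>2 * ((norm (T (adjoint T u)))\<^sup>2 + (norm (T (adjoint T v)))\<^sup>2)"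
proof -
  define p q where "p = adjoint T u" and "q = adjoint T v"
  have N: "real CARD('n) \<ge> 1"
    using zero_less_card_finite[where 'a = 'n] by linarith
  have "sum (lift_direction v u) UNIV = T p"
    by (simp add: lift_direction_def p_def q_def sum.distrib sum_axis sum_constant_scaleR
        flip: stack_def) (simp add: stack.diff)
  then have inner: "inner u (sum (lift_direction v u) UNIV) = (norm p)\<^sup>2"
    by (simp add: power2_norm_eq_inner p_def inner_stack inner_commute[of u])
  have "(\<Sum>a\<in>UNIV. (norm (lift_direction v u a))\<^sup>2)
      \<le> (\<Sum>a\<in>UNIV. 2 * (norm (T (p - q) $ a))\<^sup>2 + 2 * (norm (T q))\<^sup>2)"
  proof (rule sum_mono)
    fix a
    have "(norm (lift_direction v u a))\<^sup>2
        \<le> 2 * (norm (T (p - q) $ a))\<^sup>2 + 2 * (norm ((1 / real CARD('n)) *\<^sub>R T q))\<^sup>2"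
      unfolding lift_direction_def p_def[symmetric] q_def[symmetric]
      using norm_add_sq_le[of "axis a (A a (p - q))" "(1 / real CARD('n)) *\<^sub>R T q"]
      by (simp add: norm_sq_axis stack_def)
    moreover have "(norm ((1 / real CARD('n)) *\<^sub>R T q))\<^sup>2 \<le> (norm (T q))\<^sup>2"
      using N by (intro power_mono) (simp_all add: divide_simps mult_le_cancel_left1)
    ultimately show "(norm (lift_direction v u a))\<^sup>2
        \<le> 2 * (norm (T (p - q) $ a))\<^sup>2 + 2 * (norm (T q))\<^sup>2"
      by linarith
  qed
  also have "\<dots> = 2 * (norm (T p - T q))\<^sup>2 + real CARD('n) * (2 * (norm (T q))\<^sup>2)"
    by (simp add: norm_sq_vec[of "T p - T q"] sum.distrib sum_distrib_left stack.diff)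
  \<comment> \<open>Inserting N \<ge> 1 gives both terms a common factor that cancels the 1/N of the
    averaging.\<close>
  also have "\<dots> \<le> real CARD('n) * (2 * (norm (T p - T q))\<^sup>2) + real CARD('n) * (2 * (norm (T q))\<^sup>2)"
    using mult_right_mono[OF N, of "2 * (norm (T p - T q))\<^sup>2"] by simp
  also have "\<dots> \<le> real CARD('n) * (6 * ((norm (T p))\<^sup>2 + (norm (T q))\<^sup>2))"
  proof -
    \<comment> \<open>Splitting the difference yields coefficients 4 for \<open>T p\<close> and 4 +
      2 for \<open>T q\<close>; 6 dominates both.\<close>
    have "2 * (norm (T p - T q))\<^sup>2 + 2 * (norm (T q))\<^sup>2 \<le> 6 * ((norm (T p))\<^sup>2 + (norm (T q))\<^sup>2)"
      using norm_diff_sq_le[of "T p" "T q"] zero_le_power2[of "norm (T p)"] by argo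
    then show ?thesis
      unfolding distrib_left[symmetric] by (intro mult_left_mono) auto
  qed
  finally have "\<gamma>\<^sup>2 / real CARD('n) * (\<Sum>a\<in>UNIV. (norm (lift_direction v u a))\<^sup>2)
      \<le> \<gamma>\<^sup>2 / real CARD('n) * (real CARD('n) * (6 * ((norm (T p))\<^sup>2 + (norm (T q))\<^sup>2)))"
    by (intro mult_left_mono) auto
  also have "\<dots> = 6 * \<gamma>\<^sup>2 * ((norm (T p))\<^sup>2 + (norm (T q))\<^sup>2)"
    using N by simp
  finally have "\<gamma>\<^sup>2 / real CARD('n) * (\<Sum>a\<in>UNIV. (norm (lift_direction v u a))\<^sup>2)
      \<le> 6 * \<gamma>\<^sup>2 * ((norm (T p))\<^sup>2 + (norm (T q))\<^sup>2)" .
  moreover have "0 \<le> 2 * \<gamma> / real CARD('n) * (norm p)\<^sup>2"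
    using \<gamma> by simp
  ultimately show ?thesis
    unfolding mean_norm_sq_step inner p_def[symmetric] q_def[symmetric] by linarith
qed

lemma lift_gradient_step:
  assumes \<gamma>: "\<gamma> \<ge> 0"
  shows "(norm (v - \<gamma> *\<^sub>R T (adjoint T v)))\<^sup>2 \<le> (norm v)\<^sup>2 + \<gamma>\<^sup>2 * (norm (T (adjoint T v)))\<^sup>2"
proof -
  have "inner v (T (adjoint T v)) = (norm (adjoint T v))\<^sup>2"
    by (simp add: power2_norm_eq_inner inner_stack inner_commute[of v])
  then show ?thesis
    using \<gamma> by (simp add: norm_sq_diff_scaleR)
qed

end

section \<open>Boundedness of the lifted iteration and decay of the residuals\<close>

context svrg_iteration begin

abbreviation lift_out :: "'b ^ 'n \<Rightarrow> nat \<Rightarrow> (nat \<Rightarrow> nat \<Rightarrow> 'n) \<Rightarrow> 'b ^ 'n" where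
  "lift_out v n i \<equiv> lift_outer A \<gamma>\<^sub>0 \<gamma>\<^sub>1 m v i n"

abbreviation lift_in :: "'b ^ 'n \<Rightarrow> nat \<Rightarrow> nat \<Rightarrow> (nat \<Rightarrow> nat \<Rightarrow> 'n) \<Rightarrow> 'b ^ 'n" where
  "lift_in v n k i \<equiv> lift_inner A \<gamma>\<^sub>0 \<gamma>\<^sub>1 (lift_out v n i) (i n) k"

definition lift_energy :: "'b ^ 'n \<Rightarrow> nat \<Rightarrow> real" where
  "lift_energy v n = E (\<lambda>i. (norm (lift_out v n i))\<^sup>2)"

definition lift_inner_energy :: "'b ^ 'n \<Rightarrow> nat \<Rightarrow> nat \<Rightarrow> real" where
  "lift_inner_energy v n k = E (\<lambda>i. (norm (lift_in v n k i))\<^sup>2)"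

text \<open>Links two estimates: it bounds the growth of the lifted energy in an epoch and is itself
  bounded by the drop of the noise-free energy.\<close>

definition total_residual :: "'b ^ 'n \<Rightarrow> nat \<Rightarrow> real" where
  "total_residual v n = residual 0 (adjoint T v) n + (\<Sum>k<m. inner_residual 0 (adjoint T v) n k)"

lemma determined_lift_out: "determined_on (history m n k) (\<lambda>i. f (lift_out v n i))"
  by (rule determined_on_comp[OF determined_on_lift_outer])

lemma determined_lift_in: "k \<le> m \<Longrightarrow> determined_on (history m n k) (\<lambda>i. f (lift_in v n k i))"
  by (rule determined_on_comp[OF determined_on_lift_inner])

lemma determined_lift_in_out:
  "k \<le> m \<Longrightarrow> determined_on (history m n k) (\<lambda>i. f (lift_in v n k i) (lift_out v n i))"
  by (rule determined_on_comp2[OF determined_on_lift_inner determined_on_lift_outer])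

lemma lift_energy_nonneg: "0 \<le> lift_energy v n"
  by (simp add: lift_energy_def)

lemma lift_residual:
  "residual 0 (adjoint T v) n = E (\<lambda>i. (norm (T (adjoint T (lift_out v n i))))\<^sup>2)"
  "inner_residual 0 (adjoint T v) n k = E (\<lambda>i. (norm (T (adjoint T (lift_in v n k i))))\<^sup>2)"
  by (simp_all add: residual_def inner_residual_def svrg_lift svrg_inner_lift)

lemma lift_inner_energy_0:
  "lift_inner_energy v n 0 \<le> lift_energy v n + \<gamma>\<^sub>0\<^sup>2 * residual 0 (adjoint T v) n"
proof -
  let ?e = "\<lambda>i. (norm (lift_out v n i))\<^sup>2" and ?r = "\<lambda>i. (norm (T (adjoint T (lift_out v n i))))\<^sup>2"
  have "lift_inner_energy v n 0 \<le> E (\<lambda>i. ?e i + \<gamma>\<^sub>0\<^sup>2 * ?r i + 0 * ?r i + 0)"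
    unfolding lift_inner_energy_def lift_inner.simps
  proof (rule E_mono[where n = n and k = 0])
    show "(norm (lift_out v n i - \<gamma>\<^sub>0 *\<^sub>R T (adjoint T (lift_out v n i))))\<^sup>2
        \<le> ?e i + \<gamma>\<^sub>0\<^sup>2 * ?r i + 0 * ?r i + 0" for i
      using lift_gradient_step[of \<gamma>\<^sub>0 "lift_out v n i"] \<gamma>\<^sub>0_pos by simp
  qed (rule determined_lift_out)+
  also have "\<dots> = E ?e + \<gamma>\<^sub>0\<^sup>2 * E ?r + 0 * E ?r + 0"
    by (rule E_linear[where F = ?e and G = ?r and H = ?r]) (rule determined_lift_out)+
  finally show ?thesis by (simp add: lift_energy_def lift_residual)
qed

lemma lift_inner_energy_Suc:
  assumes k: "k < m"
  shows "lift_inner_energy v n (Suc k) \<le> lift_inner_energy v n k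
    + 6 * \<gamma>\<^sub>1\<^sup>2 * (inner_residual 0 (adjoint T v) n k + residual 0 (adjoint T v) n)"
proof -
  let ?e = "\<lambda>i. (norm (lift_in v n k i))\<^sup>2"
    and ?r' = "\<lambda>i. (norm (T (adjoint T (lift_in v n k i))))\<^sup>2"
    and ?r = "\<lambda>i. (norm (T (adjoint T (lift_out v n i))))\<^sup>2"
  let ?F = "\<lambda>a i. (norm (lift_in v n k i
      - \<gamma>\<^sub>1 *\<^sub>R lift_direction (lift_out v n i) (lift_in v n k i) a))\<^sup>2"
  have km: "k \<le> m" using k by simp
  have "lift_inner_energy v n (Suc k) = E (\<lambda>i. ?F (i n k) i)"
    by (simp add: lift_inner_energy_def lift_direction_def)
  also have "\<dots> \<le> E (\<lambda>i. ?e i + 6 * \<gamma>\<^sub>1\<^sup>2 * ?r' i + 6 * \<gamma>\<^sub>1\<^sup>2 * ?r i + 0)"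
  proof (rule expectation_step_le[where F = ?F
        and G = "\<lambda>i. ?e i + 6 * \<gamma>\<^sub>1\<^sup>2 * ?r' i + 6 * \<gamma>\<^sub>1\<^sup>2 * ?r i + 0", OF k])
    show "(\<Sum>a\<in>UNIV. ?F a i) / real CARD('n) \<le> ?e i + 6 * \<gamma>\<^sub>1\<^sup>2 * ?r' i + 6 * \<gamma>\<^sub>1\<^sup>2 * ?r i + 0" for i
      using lift_step_energy[of \<gamma>\<^sub>1 "lift_in v n k i" "lift_out v n i"] \<gamma>\<^sub>1_pos
      by (simp add: distrib_left)
  qed (rule determined_lift_in_out[OF km])+
  also have "\<dots> = E ?e + 6 * \<gamma>\<^sub>1\<^sup>2 * E ?r' + 6 * \<gamma>\<^sub>1\<^sup>2 * E ?r + 0"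
    by (rule E_linear[where F = ?e and G = ?r' and H = ?r])
      (rule determined_lift_out determined_lift_in[OF km])+
  finally show ?thesis
    unfolding lift_inner_energy_def[of v n k] lift_residual by (simp add: distrib_left)
qed

lemma lift_energy_Suc:
  "lift_energy v (Suc n) \<le> lift_energy v n + (\<gamma>\<^sub>0\<^sup>2 + 6 * \<gamma>\<^sub>1\<^sup>2 * (real m + 1)) * total_residual v n"
proof -
  let ?r = "residual 0 (adjoint T v) n" and ?r' = "inner_residual 0 (adjoint T v) n"
  have "lift_inner_energy v n k \<le> lift_inner_energy v n 0
      + 6 * \<gamma>\<^sub>1\<^sup>2 * ((\<Sum>l<k. ?r' l) + real k * ?r)" if "k \<le> m" for k
    using that
  proof (induction k)
    case (Suc k)
    then show ?case
      using lift_inner_energy_Suc[of k v n] by (simp add: algebra_simps)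
  qed simp
  from this[of m] have "lift_energy v (Suc n) \<le> lift_inner_energy v n 0
      + 6 * \<gamma>\<^sub>1\<^sup>2 * ((\<Sum>l<m. ?r' l) + real m * ?r)"
    by (simp add: lift_energy_def lift_inner_energy_def)
  then have "lift_energy v (Suc n) \<le> lift_energy v n + \<gamma>\<^sub>0\<^sup>2 * ?r
      + 6 * \<gamma>\<^sub>1\<^sup>2 * ((\<Sum>l<m. ?r' l) + real m * ?r)"
    using lift_inner_energy_0[of v n] by linarith
  moreover have "\<gamma>\<^sub>0\<^sup>2 * ?r \<le> \<gamma>\<^sub>0\<^sup>2 * total_residual v n"
    unfolding total_residual_def by (intro mult_left_mono) (simp_all add: residual_nonneg sum_nonneg)
  \<comment> \<open>Each inner step contributes its own residual once and the anchor residual again,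
    so the latter is counted \<open>m\<close> times.\<close>
  moreover have "(\<Sum>l<m. ?r' l) + real m * ?r \<le> (real m + 1) * total_residual v n"
    unfolding total_residual_def
    by (simp add: algebra_simps residual_nonneg sum_nonneg)
  then have "6 * \<gamma>\<^sub>1\<^sup>2 * ((\<Sum>l<m. ?r' l) + real m * ?r) \<le> 6 * \<gamma>\<^sub>1\<^sup>2 * ((real m + 1) * total_residual v n)"
    by (intro mult_left_mono) auto
  ultimately show ?thesis by (simp add: algebra_simps)
qed

text \<open>For zero data the noise term of the epoch estimate vanishes, and the smaller of the two
  rates serves both kinds of residual. The right side telescopes.\<close>

lemma total_residual_le:
  "min \<kappa> \<tau> * total_residual v n \<le> energy 0 (adjoint T v) n - energy 0 (adjoint T v) (Suc n)"
proof -
  let ?r = "residual 0 (adjoint T v) n" and ?s = "\<Sum>k<m. inner_residual 0 (adjoint T v) n k"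
  have "min \<kappa> \<tau> * ?r \<le> \<kappa> * ?r" "min \<kappa> \<tau> * ?s \<le> \<tau> * ?s"
    by (intro mult_right_mono; simp add: residual_nonneg sum_nonneg)+
  then show ?thesis
    using energy_Suc[of 0 "adjoint T v" n] by (simp add: total_residual_def distrib_left)
qed

lemma total_residual_nonneg: "0 \<le> total_residual v n"
  by (simp add: total_residual_def residual_nonneg sum_nonneg)

lemma min_pos: "0 < min \<kappa> \<tau>"
  using \<kappa>_pos \<tau>_pos by simp

text \<open>A Lyapunov argument: lifted energy plus \<open>c\<close> times the noise-free energy
  never increases.\<close>

lemma lift_energy_bounded: "\<exists>B. \<forall>n. lift_energy v n \<le> B"
proof -
  \<comment> \<open>The growth factor of the lifted energy over the rate of energy drop, so that the
    drop pays exactly for the growth bound.\<close>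
  define c where "c = (\<gamma>\<^sub>0\<^sup>2 + 6 * \<gamma>\<^sub>1\<^sup>2 * (real m + 1)) / min \<kappa> \<tau>"
  have c: "0 \<le> c"
    unfolding c_def using min_pos by (intro divide_nonneg_pos) auto
  let ?V = "\<lambda>n. lift_energy v n + c * energy 0 (adjoint T v) n"
  have "?V (Suc n) \<le> ?V n" for n
  proof -
    have "(\<gamma>\<^sub>0\<^sup>2 + 6 * \<gamma>\<^sub>1\<^sup>2 * (real m + 1)) * total_residual v n = c * (min \<kappa> \<tau> * total_residual v n)"
      using less_imp_neq[OF min_pos] by (simp add: c_def)
    also have "\<dots> \<le> c * (energy 0 (adjoint T v) n - energy 0 (adjoint T v) (Suc n))"
      by (rule mult_left_mono[OF total_residual_le c])
    finally show ?thesis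
      using lift_energy_Suc[of v n] by (simp add: right_diff_distrib)
  qed
  then have "?V n \<le> ?V 0" for n
    using lift_Suc_antimono_le[of ?V 0 n] by simp
  moreover have "lift_energy v n \<le> ?V n" for n
    using c by (simp add: energy_nonneg)
  ultimately show ?thesis by (meson order_trans)
qed

text \<open>The noise-free energy decreases and is nonnegative, hence converges; its successive
  differences tend to 0 and dominate the residuals.\<close>

lemma total_residual_tendsto_0: "total_residual v \<longlonglongrightarrow> 0"
proof -
  let ?e = "energy 0 (adjoint T v)"
  have "0 \<le> min \<kappa> \<tau> * total_residual v n" for n
    using min_pos by (simp add: total_residual_nonneg)
  then have "decseq ?e"
    using total_residual_le by (intro decseq_SucI) (smt (verit))
  then obtain l where l: "?e \<longlonglongrightarrow> l"
    using decseq_convergent[of ?e 0] energy_nonneg by metis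
  have "(\<lambda>n. (?e n - ?e (Suc n)) / min \<kappa> \<tau>) \<longlonglongrightarrow> (l - l) / min \<kappa> \<tau>"
    using min_pos by (intro tendsto_intros l LIMSEQ_Suc) auto
  then have "(\<lambda>n. (?e n - ?e (Suc n)) / min \<kappa> \<tau>) \<longlonglongrightarrow> 0" by simp
  then show ?thesis
  proof (rule tendsto_sandwich[rotated 3])
    show "\<forall>\<^sub>F n in sequentially. total_residual v n \<le> (?e n - ?e (Suc n)) / min \<kappa> \<tau>"
      using total_residual_le[of v] min_pos by (simp add: pos_le_divide_eq mult.commute)
  qed (auto simp: total_residual_nonneg)
qed

text \<open>For a lifted iterate u, the squared norm of \<open>adjoint T\<close> u is the inner
  product of u with its residual \<open>T (adjoint T\<close> u\<open>)\<close>; Young's inequality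
  with free weight \<open>s\<close> separates the two factors.\<close>

lemma energy_le_interpolation:
  assumes s: "s > 0"
  shows "2 * energy 0 (adjoint T v) n \<le> s * lift_energy v n + total_residual v n / s"
proof -
  let ?e = "\<lambda>i. (norm (lift_out v n i))\<^sup>2" and ?r = "\<lambda>i. (norm (T (adjoint T (lift_out v n i))))\<^sup>2"
    and ?f = "\<lambda>i. (norm (adjoint T (lift_out v n i)))\<^sup>2"
  have "energy 0 (adjoint T v) n = E ?f"
    by (simp add: energy_def svrg_lift)
  also have "\<dots> \<le> E (\<lambda>i. 0 + s / 2 * ?e i + 1 / (2 * s) * ?r i + 0)"
  proof (rule E_mono[where n = n and k = 0])
    show "?f i \<le> 0 + s / 2 * ?e i + 1 / (2 * s) * ?r i + 0" for i
    proof -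
      have "2 * ?f i = 2 * inner (lift_out v n i) (T (adjoint T (lift_out v n i)))"
        by (simp add: power2_norm_eq_inner inner_stack inner_commute[of "lift_out v n i"])
      also have "\<dots> \<le> s * ?e i + ?r i / s"
        by (rule young_inner[OF s])
      finally show ?thesis using s by (simp add: field_simps)
    qed
  qed (rule determined_lift_out)+
  also have "\<dots> = E (\<lambda>_. 0) + s / 2 * E ?e + 1 / (2 * s) * E ?r + 0"
    by (rule E_linear[where F = "\<lambda>_. 0" and G = ?e and H = ?r and n = n and k = 0])
      (rule determined_lift_out | simp add: determined_on_def)+
  finally have "2 * energy 0 (adjoint T v) n \<le> s * lift_energy v n + residual 0 (adjoint T v) n / s"
    by (simp add: lift_energy_def lift_residual)
  also have "residual 0 (adjoint T v) n / s \<le> total_residual v n / s"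
    using s by (intro divide_right_mono) (simp_all add: total_residual_def residual_nonneg sum_nonneg)
  finally show ?thesis by simp
qed

lemma energy_source_tendsto_0: "energy 0 (adjoint T v) \<longlonglongrightarrow> 0"
proof (rule LIMSEQ_I)
  fix e :: real assume e: "e > 0"
  obtain B where B: "\<And>n. lift_energy v n \<le> B"
    using lift_energy_bounded by blast
  have B0: "0 \<le> B"
    using B[of 0] lift_energy_nonneg[of v 0] by linarith
  \<comment> \<open>The weight is fixed first, making the bounded part small uniformly in
    \<open>n\<close>; only then is the residual over \<open>s\<close> made small.
    \<open>B + 1\<close> avoids a zero denominator.\<close>
  define s where "s = e / (B + 1)"
  have s: "s > 0" and sB: "s * B < e"
    using e B0 by (simp_all add: s_def field_simps)
  obtain n0 where n0: "\<And>n. n \<ge> n0 \<Longrightarrow> total_residual v n < s * e"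
    using order_tendstoD(2)[OF total_residual_tendsto_0[of v], of "s * e"] s e
    by (auto simp: eventually_sequentially)
  have "norm (energy 0 (adjoint T v) n - 0) < e" if n: "n \<ge> n0" for n
  proof -
    have "total_residual v n / s < e"
      using n0[OF n] s by (simp add: field_simps)
    moreover have "s * lift_energy v n \<le> s * B"
      using s B by simp
    ultimately show ?thesis
      using energy_le_interpolation[OF s, of v n] sB energy_nonneg[of 0 "adjoint T v" n] by simp
  qed
  then show "\<exists>n0. \<forall>n\<ge>n0. norm (energy 0 (adjoint T v) n - 0) < e" by blast
qed

section \<open>Error splitting and convergence\<close>

text \<open>Superposition with three runs: the solution stays fixed, the source part
  \<open>adjoint T v\<close> runs without noise, and the remainder of the start carries all of
  it.\<close>

lemma mean_square_error_le:
  "E (\<lambda>i. (norm (outer (T x + w) x0 n i - x))\<^sup>2)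
    \<le> 2 * energy 0 (adjoint T v) n
      + 2 * ((norm (x0 - x - adjoint T v))\<^sup>2 + real n * (noise_const * (norm w)\<^sup>2))"
proof -
  define r where "r = x0 - x - adjoint T v"
  let ?e = "\<lambda>i. (norm (outer 0 (adjoint T v) n i))\<^sup>2" and ?f = "\<lambda>i. (norm (outer w r n i))\<^sup>2"
  have split: "outer (T x + w) x0 n i - x = outer 0 (adjoint T v) n i + outer w r n i" for i
  proof -
    have "outer (T x + w) x0 n i = outer (T x + (0 + w)) (x + (adjoint T v + r)) n i"
      by (simp add: r_def)
    also have "\<dots> = x + (outer 0 (adjoint T v) n i + outer w r n i)"
      by (simp only: svrg_add svrg_solution)
    finally show ?thesis by simp
  qed
  have "E (\<lambda>i. (norm (outer (T x + w) x0 n i - x))\<^sup>2) \<le> E (\<lambda>i. 0 + 2 * ?e i + 2 * ?f i + 0)"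
  proof (rule E_mono[where n = n and k = 0])
    show "(norm (outer (T x + w) x0 n i - x))\<^sup>2 \<le> 0 + 2 * ?e i + 2 * ?f i + 0" for i
      unfolding split using norm_add_sq_le by simp
  qed (rule determined_outer determined_on_comp2[OF determined_outer determined_outer])+
  also have "\<dots> = E (\<lambda>_. 0) + 2 * E ?e + 2 * E ?f + 0"
    by (rule E_linear[where F = "\<lambda>_. 0" and G = ?e and H = ?f and n = n and k = 0])
      (rule determined_outer | simp add: determined_on_def)+
  also have "\<dots> = 2 * energy 0 (adjoint T v) n + 2 * energy w r n"
    by (simp add: energy_def)
  finally show ?thesis
    using energy_le[of w r n] by (simp add: r_def)
qed

end

theorem theorem4p4:
  fixes A :: "'n::finite \<Rightarrow> 'a::{real_inner,complete_space} \<Rightarrow> 'b::{real_inner,complete_space}"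
    and Y :: "'n \<Rightarrow> 'b set"
    and y :: "'b ^ 'n"
    and y\<delta> :: "real \<Rightarrow> 'b ^ 'n"
    and x0 :: 'a
    and m :: nat
    and \<gamma>\<^sub>0 \<gamma>\<^sub>1 :: real
    and M :: "'w measure"
    and idx :: "nat \<Rightarrow> nat \<Rightarrow> 'w \<Rightarrow> 'n"
    and n\<delta> :: "real \<Rightarrow> nat"
  assumes Y_subspace: "\<And>i. subspace (Y i)"
    and Y_closed: "\<And>i. closed (Y i)"
    and A_bounded_linear: "\<And>i. bounded_linear (A i)"
    and A_range: "\<And>i. range (A i) \<subseteq> Y i"
    and exact_data: "y \<in> range (stack A)"
    and noisy_data_Y: "\<And>\<delta> i. \<delta> > 0 \<Longrightarrow> y\<delta> \<delta> $ i \<in> Y i"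
    and noise_level: "\<And>\<delta>. \<delta> > 0 \<Longrightarrow> norm (y\<delta> \<delta> - y) \<le> \<delta>"
    and m_pos: "m \<ge> 1"
    and prob: "prob_space M"
    and idx_indep: "prob_space.indep_vars M (\<lambda>_. count_space UNIV)
                      (\<lambda>(n, k). idx n k) (UNIV \<times> {..<m})"
    and idx_uniform: "\<And>n k. k < m \<Longrightarrow>
                      distr M (count_space UNIV) (idx n k) = uniform_count_measure UNIV"
    and \<gamma>\<^sub>0_pos: "\<gamma>\<^sub>0 > 0"
    and \<gamma>\<^sub>1_pos: "\<gamma>\<^sub>1 > 0"
    and step1: "1 - \<gamma>\<^sub>1 * max_sq_norm A > 0"
    and step2: "2 * \<gamma>\<^sub>0 - \<gamma>\<^sub>0\<^sup>2 * (onorm (stack A))\<^sup>2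
                  - 2 * real m * \<gamma>\<^sub>1\<^sup>2 * max_sq_norm A / real CARD('n) > 0"
    and n_infty: "filterlim n\<delta> at_top (at_right 0)"
    and n_noise: "((\<lambda>\<delta>. \<delta>\<^sup>2 * real (n\<delta> \<delta>)) \<longlongrightarrow> 0) (at_right 0)"
  shows "((\<lambda>\<delta>. prob_space.expectation M (\<lambda>\<omega>.
             (norm (svrg A (y\<delta> \<delta>) \<gamma>\<^sub>0 \<gamma>\<^sub>1 m x0 (\<lambda>n k. idx n k \<omega>) (n\<delta> \<delta>)
                     - min_norm_solution (stack A) y x0))\<^sup>2))
          \<longlongrightarrow> 0) (at_right 0)"
proof -
  interpret svrg_iteration A M idx m \<gamma>\<^sub>0 \<gamma>\<^sub>1
  proof (intro svrg_iteration.intro operator_family.intro uniform_indices.intro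
      uniform_indices_axioms.intro svrg_iteration_axioms.intro)
    show "\<gamma>\<^sub>1 * max_sq_norm A < 1" using step1 by simp
  qed (fact A_bounded_linear prob idx_indep idx_uniform \<gamma>\<^sub>0_pos \<gamma>\<^sub>1_pos step2)+
  define xd where "xd = min_norm_solution T y x0"
  have y: "T xd = y" and orth: "\<And>d. T d = 0 \<Longrightarrow> inner (x0 - xd) d = 0"
    unfolding xd_def using min_norm_solution_properties[OF bounded_linear_stack exact_data] by auto
  have C: "noise_const \<ge> 0"
    unfolding noise_const_def using \<kappa>_pos \<gamma>\<^sub>1_pos inner_step_size by (intro add_nonneg_nonneg) auto
  let ?err = "\<lambda>\<delta>. E (\<lambda>i. (norm (outer (y\<delta> \<delta>) x0 (n\<delta> \<delta>) i - xd))\<^sup>2)"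
  have "(?err \<longlongrightarrow> 0) (at_right 0)"
  proof (rule tendstoI)
    fix e :: real assume e: "e > 0"
    have "x0 - xd \<in> closure (range (adjoint T))"
      by (rule orthogonal_kernel_in_closure_range_adjoint[OF bounded_linear_stack orth])
    \<comment> \<open>\<open>v\<close> depends on \<open>e\<close> but not on \<delta>, so the
      possibly slow decay of the source part is harmless. The bound doubles the squared remainder,
      so e/4 keeps its limit below e/2.\<close>
    then obtain v where "dist (adjoint T v) (x0 - xd) < sqrt (e / 4)"
      using e unfolding closure_approachable by (metis rangeE real_sqrt_gt_0_iff divide_pos_pos zero_less_numeral)
    then have "(norm (x0 - xd - adjoint T v))\<^sup>2 < (sqrt (e / 4))\<^sup>2"
      by (intro power_strict_mono) (auto simp: dist_norm norm_minus_commute)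
    then have v: "(norm (x0 - xd - adjoint T v))\<^sup>2 < e / 4"
      using e by simp
    let ?bound = "\<lambda>\<delta>. 2 * energy 0 (adjoint T v) (n\<delta> \<delta>)
      + 2 * ((norm (x0 - xd - adjoint T v))\<^sup>2 + noise_const * (\<delta>\<^sup>2 * real (n\<delta> \<delta>)))"
    \<comment> \<open>The source part vanishes because the number of epochs tends to infinity, the
      noise part by the stopping rule; only the remainder of the start survives.\<close>
    have "(?bound \<longlongrightarrow> 2 * 0 + 2 * ((norm (x0 - xd - adjoint T v))\<^sup>2 + noise_const * 0)) (at_right 0)"
      by (intro tendsto_intros n_noise filterlim_compose[OF energy_source_tendsto_0 n_infty])
    then have "\<forall>\<^sub>F \<delta> in at_right 0. ?bound \<delta> < e"
      by (rule order_tendstoD(2)) (use v e in simp)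
    moreover have "\<forall>\<^sub>F \<delta> in at_right 0. (\<delta> :: real) > 0"
      by (rule eventually_at_right_less)
    ultimately show "\<forall>\<^sub>F \<delta> in at_right 0. dist (?err \<delta>) 0 < e"
    proof eventually_elim
      case (elim \<delta>)
      have "(norm (y\<delta> \<delta> - y))\<^sup>2 \<le> \<delta>\<^sup>2"
        using noise_level[of \<delta>] elim by (intro power_mono) auto
      then have "real (n\<delta> \<delta>) * (noise_const * (norm (y\<delta> \<delta> - y))\<^sup>2)
          \<le> real (n\<delta> \<delta>) * (noise_const * \<delta>\<^sup>2)"
        using C by (intro mult_left_mono) auto
      then have "?err \<delta> \<le> ?bound \<delta>"
        using mean_square_error_le[of xd "y\<delta> \<delta> - y" x0 "n\<delta> \<delta>" v] by (simp add: y mult_ac)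
      moreover have "?err \<delta> \<ge> 0" by simp
      ultimately show ?case using elim by simp
    qed
  qed
  then show ?thesis by (simp add: xd_def)
qed

end
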